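(* The group homomorphism $\widetilde\rho\colon\mathrm U(2)^{\pm1}\to\mathrm O(3)$ (described in the context) sets up, via $\mathsf G\mapsto\widetilde\rho^{-1}(\mathsf G)$, a bijection between the finite subgroups $\mathsf G\leqslant\mathrm O(3)$ generated by reflections and the finite subgroups of $\mathrm U(2)^{\pm1}$ that contain $-\mathbf 1$ and are generated by reflections. Further, the finite subgroups of $\mathrm U(2)^{\pm1}$ that do not contain $-\mathbf 1$ but are generated by reflections are the dihedral groups $\mathsf D_{2m+1}$, for $m\geqslant0$, and those are mapped isomorphically via $\widetilde\rho$ onto their images in $\mathrm O(3)$.
   Context: $\mathrm U(2)^{\pm1}=\{A\in\mathrm{GL}(2,\mathbb C)\mid A\overline A^{T}=\mathbf 1,\ \det A=\pm1\}$. A reflection of a finite dimensional vector space $V$ over a field of characteristic not $2$ is a linear map $v\mapsto v-2\lambda(v)a$ with $\lambda$ a linear form on $V$ and $a\in V$, $\lambda(a)=1$. Elements of $\mathrm U(2)^{\pm1}$ are considered as linear maps of $\mathbb C^2$. $\mathsf D_n$ denotes the dihedral group of order $2n$. Let $\mathfrak{su}(2)=\{B\in\mathrm{Mat}_{2\times2}(\mathbb C)\mid \overline B^{T}=-B,\ \operatorname{tr}B=0\}$, a $3$-dimensional real vector space on which $\det$ is the standard Euclidean square norm; $\mathrm O(3)$ is identified with the group of $\mathbb R$-linear automorphisms of $\mathfrak{su}(2)$ preserving $\det$. For $A\in\mathrm U(2)^{\pm1}$ and $B\in\mathfrak{su}(2)$, $\widetilde\rho(A)(B)=(\det A)\,A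BA^{-1}$.
   Formalization: "Generated by reflections" means generated by a nonempty set of reflections, so the trivial group is excluded; its preimage {1,-1} contains no reflection, and the trivial subgroup of U(2)^{±1} is not a dihedral group D_{2m+1}. *)

theory Defs
  imports "HOL-Analysis.Analysis" "HOL-Algebra.Generated_Groups" "HOL-Algebra.Bij"
begin

definition conj_transpose :: "complex^'n^'m \<Rightarrow> complex^'m^'n" where
  "conj_transpose A = (\<chi> i j. cnj (A $ j $ i))"

definition U2pm :: "(complex^2^2) monoid" where
  "U2pm = \<lparr>carrier = {A. invertible A \<and> A ** conj_transpose A = mat 1 \<and> (det A = 1 \<or> det A = - 1)},
           mult = (**), one = mat 1\<rparr>"

definition su2 :: "(complex^2^2) set" where
  "su2 = {B. conj_transpose B = - B \<and> trace B = 0}"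

text \<open>
  Linear maps and reflections of a vector space given by a carrier set \<open>V\<close> and a scalar
  multiplication \<open>s\<close>; the real vector space \<^term>\<open>su2\<close> is a subset of a type, not a type.
\<close>

definition linear_on :: "('k \<Rightarrow> 'v::ab_group_add \<Rightarrow> 'v) \<Rightarrow> ('k \<Rightarrow> 'w::ab_group_add \<Rightarrow> 'w)
    \<Rightarrow> 'v set \<Rightarrow> ('v \<Rightarrow> 'w) \<Rightarrow> bool" where
  "linear_on s t V f \<longleftrightarrow>
     (\<forall>x\<in>V. \<forall>y\<in>V. f (x + y) = f x + f y) \<and> (\<forall>c. \<forall>x\<in>V. f (s c x) = t c (f x))"

definition is_reflection :: "('k::field \<Rightarrow> 'v::ab_group_add \<Rightarrow> 'v) \<Rightarrow> 'v set \<Rightarrow> ('v \<Rightarrow> 'v) \<Rightarrow> bool" where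
  "is_reflection s V f \<longleftrightarrow>
     (\<exists>l a. linear_on s (*) V l \<and> a \<in> V \<and> l a = 1 \<and> (\<forall>v\<in>V. f v = v - s (2 * l v) a))"

text \<open>
  The automorphisms of \<^term>\<open>su2\<close> are functions on the ambient matrix type; as everywhere in
  \<^const>\<open>BijGroup\<close>, they are extensional (\<^const>\<open>undefined\<close> outside \<^term>\<open>su2\<close>), so
  that equality of functions is equality of maps on \<^term>\<open>su2\<close>.
\<close>

definition O3 :: "(complex^2^2 \<Rightarrow> complex^2^2) monoid" where
  "O3 = BijGroup su2 \<lparr>carrier :=
     {f \<in> Bij su2. linear_on (*\<^sub>R) (*\<^sub>R) su2 f \<and> (\<forall>B\<in>su2. det (f B) = det B)}\<rparr>"

definition rho :: "complex^2^2 \<Rightarrow> complex^2^2 \<Rightarrow> complex^2^2" where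
  "rho A = (\<lambda>B\<in>su2. \<chi> i j. det A * (A ** B ** matrix_inv A) $ i $ j)"

definition reflections_U2pm :: "(complex^2^2) set" where
  "reflections_U2pm = {A \<in> carrier U2pm. is_reflection (*s) UNIV ((*v) A)}"

definition reflections_O3 :: "(complex^2^2 \<Rightarrow> complex^2^2) set" where
  "reflections_O3 = {f \<in> carrier O3. is_reflection (*\<^sub>R) su2 f}"

text \<open>
  A group generated by reflections is generated by a \<^emph>\<open>nonempty\<close> set of reflections: the trivial
  group does not count. (The preimage under \<^const>\<open>rho\<close> of the trivial subgroup is the group
  consisting of \<open>1\<close> and \<open>-1\<close>, which contains no reflection; and the trivial group is not of the
  form \<open>D\<^sub>n\<close> with \<open>n\<close> positive.)
\<close>

definition finite_reflection_subgroups :: "('a, 'b) monoid_scheme \<Rightarrow> 'a set \<Rightarrow> 'a set set" where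
  "finite_reflection_subgroups G S =
     {H. subgroup H G \<and> finite H \<and> (\<exists>R. R \<noteq> {} \<and> R \<subseteq> S \<and> H = generate G R)}"

text \<open>
  The dihedral group of order \<open>2n\<close> (\<open>n > 0\<close>) as the semidirect product of the integers modulo
  \<open>n\<close> with the sign group, which acts by multiplication.
\<close>

definition dihedral :: "nat \<Rightarrow> (int \<times> int) monoid" where
  "dihedral n = \<lparr>carrier = {0..<int n} \<times> {1, - 1},
                 mult = (\<lambda>(i, s) (j, t). ((i + s * j) mod int n, s * t)), one = (0, 1)\<rparr>"

lemma group_dihedral:
  assumes "n > 0"
  shows "group (dihedral n)"
proof (rule groupI)
  fix x y z assume "x \<in> carrier (dihedral n)" "y \<in> carrier (dihedral n)" "z \<in> carrier (dihedral n)"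
  then show "x \<otimes>\<^bsub>dihedral n\<^esub> y \<otimes>\<^bsub>dihedral n\<^esub> z = x \<otimes>\<^bsub>dihedral n\<^esub> (y \<otimes>\<^bsub>dihedral n\<^esub> z)"
    by (auto simp: dihedral_def mod_simps algebra_simps)
next
  fix x assume "x \<in> carrier (dihedral n)"
  then obtain i s where x: "x = (i, s)" "0 \<le> i" "i < int n" "s = 1 \<or> s = - 1"
    by (auto simp: dihedral_def)
  show "\<exists>y\<in>carrier (dihedral n). y \<otimes>\<^bsub>dihedral n\<^esub> x = \<one>\<^bsub>dihedral n\<^esub>"
    using assms x
    by (intro bexI[of _ "((- s * i) mod int n, s)"]) (auto simp: dihedral_def mod_simps)
qed (use assms in \<open>auto simp: dihedral_def\<close>)

lemma order_dihedral: "order (dihedral n) = 2 * n"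
  by (simp add: order_def dihedral_def card_cartesian_product)

end

theory Submission
  imports Defs
begin

text \<open>
  Up to the scalar \<open>\<i>\<close>, the elements of \<open>U(2)\<^sup>\<plusminus>\<^sup>1\<close> are unit quaternions, \<open>su(2)\<close> is the space of purely
  imaginary quaternions, and the reflections of \<open>\<complex>\<^sup>2\<close> are exactly the \<open>\<i> a\<close> with \<open>a\<close> imaginary of norm
  one. Since \<open>rho (\<i> a)\<close> is the reflection of \<open>su(2)\<close> in the plane orthogonal to \<open>a\<close>, every reflection of
  \<open>su(2)\<close> lifts. The kernel of \<open>rho\<close> is \<open>{1, -1}\<close>, and \<open>-1 = A (- A)\<close> for every reflection \<open>A\<close>; so a
  preimage under \<open>rho\<close> of a reflection group is generated by the preimages of the reflections.

  Let \<open>H\<close> be a finite reflection group without \<open>-1\<close> and \<open>K\<close> its subgroup of elements of determinant one.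
  By Cayley-Hamilton \<open>p\<^sup>2 = 2 Re(p) p - 1\<close>, so squaring is injective on \<open>K\<close>, as \<open>-1\<close> is missing.
  If \<open>K\<close> is not trivial, then \<open>\<Sum>p = 0\<close> over \<open>K\<close>, because a nonzero sum would be fixed by left
  multiplication; taking real parts of squares, \<open>\<Sum>(2 Re(p)\<^sup>2 - 1) = \<Sum>Re(p) = 0\<close>. Hence the traces
  \<open>4 Re(p)\<^sup>2 - 1\<close> of the rotations \<open>rho p\<close> add up to \<open>card K > 0\<close>, and \<open>K\<close> fixes a vector \<open>b \<noteq> 0\<close> of
  \<open>su(2)\<close>. So \<open>K\<close> lies in the circle group \<open>\<real> + \<real> b\<close> and is a group of roots of unity, of odd order as
  \<open>-1\<close> is missing, which every reflection in \<open>H\<close> inverts.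
\<close>

section \<open>Unitary matrices as quaternions\<close>

text \<open>
  \<open>quat c w v\<close> is the quaternion with real part \<open>w\<close> and imaginary part \<open>v\<close>, times the complex scalar \<open>c\<close>;
  the scalars \<open>1\<close> and \<open>\<i>\<close> account for the determinants \<open>1\<close> and \<open>-1\<close>.
\<close>

definition quat :: "complex \<Rightarrow> real \<Rightarrow> real^3 \<Rightarrow> complex^2^2" where
  "quat c w v = vector [vector [c * Complex w (v$1), c * Complex (v$2) (v$3)],
                        vector [c * Complex (- (v$2)) (v$3), c * Complex w (- (v$1))]]"

lemma quat_nth [simp]:
  "quat c w v $ 1 $ 1 = c * Complex w (v$1)" "quat c w v $ 1 $ 2 = c * Complex (v$2) (v$3)"
  "quat c w v $ 2 $ 1 = c * Complex (- (v$2)) (v$3)" "quat c w v $ 2 $ 2 = c * Complex w (- (v$1))"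
  by (simp_all add: quat_def)

lemma quat_inject [simp]: "c \<noteq> 0 \<Longrightarrow> quat c w v = quat c w' v' \<longleftrightarrow> w = w' \<and> v = v'"
  by (auto simp: vec_eq_iff forall_2 forall_3)

lemma inner_real3: "u \<bullet> v = u$1 * v$1 + u$2 * v$2 + u$3 * v$3" for u v :: "real^3"
  by (simp add: inner_vec_def sum_3)

lemma quat_mult:
  "quat c w v ** quat c' w' v'
     = quat (c * c') (w * w' - v \<bullet> v') (w *\<^sub>R v' + w' *\<^sub>R v + cross3 v v')"
  by (simp add: vec_eq_iff forall_2 matrix_matrix_mult_def sum_2 inner_real3 cross3_def complex_eq_iff
      algebra_simps)

lemma det_quat: "det (quat c w v) = c\<^sup>2 * of_real (w\<^sup>2 + v \<bullet> v)"
  by (simp add: det_2 inner_real3 complex_eq_iff power2_eq_square algebra_simps)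

lemma trace_quat: "trace (quat c w v) = 2 * c * of_real w"
  by (simp add: trace_def sum_2 complex_eq_iff algebra_simps)

lemma conj_transpose_quat: "conj_transpose (quat c w v) = quat (cnj c) w (- v)"
  by (simp add: conj_transpose_def vec_eq_iff forall_2 complex_eq_iff)

lemma quat_uminus: "- quat c w v = quat c (- w) (- v)"
  by (simp add: vec_eq_iff forall_2 complex_eq_iff algebra_simps)

lemma quat_uminus_scalar: "quat (- c) w v = quat c (- w) (- v)"
  by (simp add: vec_eq_iff forall_2 complex_eq_iff algebra_simps)

lemma quat_one: "quat 1 1 0 = mat 1"
  by (simp add: vec_eq_iff forall_2 mat_def complex_eq_iff)

lemma quat_add: "quat c w v + quat c w' v' = quat c (w + w') (v + v')"
  by (simp add: vec_eq_iff forall_2 complex_eq_iff algebra_simps)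

lemma quat_diff: "quat c w v - quat c w' v' = quat c (w - w') (v - v')"
  by (simp add: vec_eq_iff forall_2 complex_eq_iff algebra_simps)

lemma quat_scaleR: "r *\<^sub>R quat c w v = quat c (r * w) (r *\<^sub>R v)"
  by (simp add: vec_eq_iff forall_2 complex_eq_iff algebra_simps)

lemma quat_scale: "(\<chi> i j. d * quat c w v $ i $ j) = quat (d * c) w v"
  by (simp add: vec_eq_iff forall_2 algebra_simps)

lemma su2_eq_quat: "su2 = range (quat 1 0)"
proof -
  have "B \<in> range (quat 1 0)" if B: "B \<in> su2" for B
  proof -
    have "cnj (B$i$j) = - B$j$i" for i j
      using B by (auto simp: su2_def conj_transpose_def vec_eq_iff)
    from this[of 1 1] this[of 1 2] this[of 2 2] have "B = quat 1 0 (vector [Im (B$1$1), Re (B$1$2), Im (B$1$2)])"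
      using B by (auto simp: vec_eq_iff forall_2 su2_def trace_def sum_2 complex_eq_iff)
    then show ?thesis by blast
  qed
  then show ?thesis
    by (auto simp: su2_def conj_transpose_quat trace_quat quat_uminus)
qed

lemma su2E:
  assumes "B \<in> su2" obtains u where "B = quat 1 0 u"
  using assms by (auto simp: su2_eq_quat)

lemma quat_in_su2 [simp]: "quat 1 0 u \<in> su2"
  by (simp add: su2_eq_quat)

lemma quat_mult_inverse:
  assumes "c * c' = 1" "w\<^sup>2 + v \<bullet> v = 1"
  shows "quat c w v ** quat c' w (- v) = mat 1" "quat c' w (- v) ** quat c w v = mat 1"
  using assms by (simp_all add: quat_mult quat_one[symmetric] power2_eq_square mult.commute)

lemma matrix_inv_unique:
  fixes A B :: "'a::semiring_1^'n^'n"
  assumes "A ** B = mat 1" "B ** A = mat 1"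
  shows "matrix_inv A = B"
proof -
  have "matrix_inv A ** A = mat 1" "A ** matrix_inv A = mat 1"
    using assms someI_ex[of "\<lambda>X. A ** X = mat 1 \<and> X ** A = mat 1"] by (auto simp: matrix_inv_def)
  then show ?thesis
    by (metis assms(1) matrix_mul_assoc matrix_mul_lid matrix_mul_rid)
qed

lemma matrix_inv_quat:
  assumes "c * c' = 1" "w\<^sup>2 + v \<bullet> v = 1"
  shows "matrix_inv (quat c w v) = quat c' w (- v)"
  using quat_mult_inverse[OF assms] by (rule matrix_inv_unique)

lemma quat_in_U2pm:
  assumes "c = 1 \<or> c = \<i>" "w\<^sup>2 + v \<bullet> v = 1"
  shows "quat c w v \<in> carrier U2pm"
proof -
  have "c * cnj c = 1" using assms by auto
  note q = quat_mult_inverse[OF this assms(2)]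
  moreover have "invertible (quat c w v)" using q by (auto simp: invertible_def)
  ultimately show ?thesis using assms by (auto simp: U2pm_def conj_transpose_quat det_quat)
qed

text \<open>Unitarity determines the second row from the first through the adjugate, which leaves a
  unit quaternion in determinant one. In determinant minus one, dividing by \<open>\<i>\<close>
  reduces to that case.\<close>

lemma U2pm_cases:
  assumes "A \<in> carrier U2pm"
  obtains c w v where "c = 1 \<or> c = \<i>" "w\<^sup>2 + v \<bullet> v = 1" "A = quat c w v"
proof -
  define a b p q where "a = A$1$1" and "b = A$1$2" and "p = A$2$1" and "q = A$2$2"
  note abpq = a_def[symmetric] b_def[symmetric] p_def[symmetric] q_def[symmetric]
  have 1: "a * cnj a + b * cnj b = 1" "p * cnj a + q * cnj b = 0" "p * cnj p + q * cnj q = 1"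
    and det: "a * q - b * p = 1 \<or> a * q - b * p = -1"
    using assms by (auto simp: U2pm_def conj_transpose_def matrix_matrix_mult_def mat_def sum_2
        vec_eq_iff forall_2 det_2 abpq)
  define d where "d = a * q - b * p"
  \<comment> \<open>The adjugate of \<open>A\<close> is \<open>d\<close> times its conjugate transpose.\<close>
  have q: "q = d * cnj a"
  proof -
    have "d * cnj a = q * (a * cnj a) - b * (p * cnj a)" by (simp add: d_def algebra_simps)
    also have "p * cnj a = - q * cnj b" using 1(2) by (simp add: add_eq_0_iff2)
    also have "q * (a * cnj a) - b * (- q * cnj b) = q * (a * cnj a + b * cnj b)" by algebra
    finally show ?thesis using 1 by simp
  qed
  have p: "p = - d * cnj b"
  proof -
    have "- d * cnj b = p * (b * cnj b) - a * (q * cnj b)" by (simp add: d_def algebra_simps)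
    also have "q * cnj b = - p * cnj a" using 1(2) by (simp add: add_eq_0_iff)
    also have "p * (b * cnj b) - a * (- p * cnj a) = p * (a * cnj a + b * cnj b)" by algebra
    finally show ?thesis using 1 by simp
  qed
  have n: "(Re a)\<^sup>2 + (Im a)\<^sup>2 + (Re b)\<^sup>2 + (Im b)\<^sup>2 = 1"
    using 1(1) by (simp add: complex_eq_iff power2_eq_square)
  show thesis
  proof (cases "d = 1")
    case True
    show thesis
    proof (rule that[of 1 "Re a" "vector [Im a, Re b, Im b]"])
      show "A = quat 1 (Re a) (vector [Im a, Re b, Im b])"
        using True p q by (simp add: vec_eq_iff forall_2 abpq complex_eq_iff)
    qed (use n in \<open>simp_all add: inner_real3 power2_eq_square\<close>)
  next
    case False
    then have "d = -1" using det by (auto simp: d_def)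
    show thesis
    \<comment> \<open>These are the coordinates of the first row divided by
      \<open>\<i>\<close>.\<close>
    proof (rule that[of \<i> "Im a" "vector [- Re a, Im b, - Re b]"])
      show "A = quat \<i> (Im a) (vector [- Re a, Im b, - Re b])"
        using \<open>d = -1\<close> p q by (simp add: vec_eq_iff forall_2 abpq complex_eq_iff)
    qed (use n in \<open>simp_all add: inner_real3 power2_eq_square\<close>)
  qed
qed

lemma U2pm_simps [simp]: "x \<otimes>\<^bsub>U2pm\<^esub> y = x ** y" "\<one>\<^bsub>U2pm\<^esub> = mat 1"
  by (simp_all add: U2pm_def)

text \<open>Euler's four-square identity. It later excludes zero divisors among the
  quaternions.\<close>

lemma quat_norm_mult:
  fixes v v' :: "real^3"
  shows "(w * w' - v \<bullet> v')\<^sup>2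
    + (w *\<^sub>R v' + w' *\<^sub>R v + cross3 v v') \<bullet> (w *\<^sub>R v' + w' *\<^sub>R v + cross3 v v')
    = (w\<^sup>2 + v \<bullet> v) * (w'\<^sup>2 + v' \<bullet> v')"
  by (simp add: inner_real3 cross3_def power2_eq_square algebra_simps)

section \<open>The group structures on both sides\<close>

lemma U2pm_det: "A \<in> carrier U2pm \<Longrightarrow> det A = 1 \<or> det A = -1"
  by (simp add: U2pm_def)

lemma U2pm_invertible: "A \<in> carrier U2pm \<Longrightarrow> A ** matrix_inv A = mat 1 \<and> matrix_inv A ** A = mat 1"
  by (auto simp: U2pm_def invertible_def matrix_inv_unique)

lemma conj_transpose_mult: "conj_transpose (A ** B) = conj_transpose B ** conj_transpose A"
  by (simp add: conj_transpose_def matrix_matrix_mult_def vec_eq_iff mult.commute)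

lemma group_U2pm: "group U2pm"
proof (rule groupI)
  fix A B assume A: "A \<in> carrier U2pm" and B: "B \<in> carrier U2pm"
  have "A ** B ** conj_transpose (A ** B) = A ** (B ** conj_transpose B) ** conj_transpose A"
    by (simp add: conj_transpose_mult matrix_mul_assoc)
  with A B show "A \<otimes>\<^bsub>U2pm\<^esub> B \<in> carrier U2pm"
    by (auto simp: U2pm_def det_mul invertible_mult)
next
  fix A assume A: "A \<in> carrier U2pm"
  then have e: "A ** conj_transpose A = mat 1" by (simp add: U2pm_def)
  then have e': "conj_transpose A ** A = mat 1" by (simp add: matrix_left_right_inverse)
  have "det (conj_transpose A) * det A = 1" by (metis e' det_mul det_I)
  moreover have "conj_transpose (conj_transpose A) = A" by (simp add: conj_transpose_def vec_eq_iff)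
  ultimately have "conj_transpose A \<in> carrier U2pm"
    using e e' U2pm_det[OF A] by (auto simp: U2pm_def invertible_def minus_equation_iff)
  with e' show "\<exists>B\<in>carrier U2pm. B \<otimes>\<^bsub>U2pm\<^esub> A = \<one>\<^bsub>U2pm\<^esub>" by auto
qed (auto simp: matrix_mul_assoc, simp add: quat_in_U2pm flip: quat_one)

interpretation U2pm: group U2pm by (rule group_U2pm)

text \<open>\<open>O3\<close> is \<open>BijGroup su2\<close> with a smaller carrier, so a subgroup
  check suffices. Linearity passes to inverses by injectivity.\<close>

lemma group_O3: "group O3"
proof -
  let ?C = "carrier O3"
  interpret B: group "BijGroup su2" by (rule group_BijGroup)
  have C: "?C = {f \<in> Bij su2. linear_on (*\<^sub>R) (*\<^sub>R) su2 f \<and> (\<forall>B\<in>su2. det (f B) = det B)}"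
    by (simp add: O3_def)
  have cl: "x + y \<in> su2" "r *\<^sub>R x \<in> su2" if "x \<in> su2" "y \<in> su2" for x y r
    using that by (auto elim!: su2E simp: quat_add quat_scaleR)
  have "subgroup ?C (BijGroup su2)"
  proof (rule B.subgroupI)
    show "?C \<subseteq> carrier (BijGroup su2)" by (auto simp: C BijGroup_def)
    have "(\<lambda>x\<in>su2. x) \<in> ?C" by (auto simp: C id_Bij linear_on_def cl)
    then show "?C \<noteq> {}" by blast
  next
    fix f assume f: "f \<in> ?C"
    \<comment> \<open>Inverses in \<open>BijGroup\<close> are extensional, hence the restriction to
      \<open>su2\<close>.\<close>
    define g where "g = (\<lambda>x\<in>su2. inv_into su2 f x)"
    have fB: "f \<in> Bij su2" and f_lin: "linear_on (*\<^sub>R) (*\<^sub>R) su2 f" and f_det: "\<And>B. B \<in> su2 \<Longrightarrow> det (f B) = det B"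
      using f by (auto simp: C)
    have bij: "bij_betw f su2 su2" using fB by (simp add: Bij_def)
    have gB: "g \<in> Bij su2" unfolding g_def by (rule restrict_inv_into_Bij[OF fB])
    have gi: "g x \<in> su2" "f (g x) = x" if "x \<in> su2" for x
      using that bij by (auto simp: g_def bij_betw_inv_into_right Bij_inv_into_mem[OF fB])
    have eqI: "x = y" if "f x = f y" "x \<in> su2" "y \<in> su2" for x y
      using that bij by (meson bij_betw_imp_inj_on inj_onD)
    have "g (x + y) = g x + g y" if "x \<in> su2" "y \<in> su2" for x y
      by (rule eqI) (use that f_lin in \<open>simp_all add: gi cl linear_on_def\<close>)
    moreover have "g (r *\<^sub>R x) = r *\<^sub>R g x" if "x \<in> su2" for x r
      by (rule eqI) (use that f_lin in \<open>simp_all add: gi cl linear_on_def\<close>)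
    moreover have "det (g x) = det x" if "x \<in> su2" for x
      using f_det[of "g x"] gi that by simp
    ultimately have "g \<in> ?C" using gB by (simp add: C linear_on_def)
    moreover have "inv\<^bsub>BijGroup su2\<^esub> f = g"
    proof (rule B.inv_equality)
      show "g \<otimes>\<^bsub>BijGroup su2\<^esub> f = \<one>\<^bsub>BijGroup su2\<^esub>"
        using fB gB Bij_compose_restrict_eq[OF fB] by (simp add: BijGroup_def g_def)
    qed (use fB gB in \<open>simp_all add: BijGroup_def\<close>)
    ultimately show "inv\<^bsub>BijGroup su2\<^esub> f \<in> ?C" by simp
  next
    fix f g assume "f \<in> ?C" "g \<in> ?C"
    then have Bij: "f \<in> Bij su2" "g \<in> Bij su2"
      and lin: "linear_on (*\<^sub>R) (*\<^sub>R) su2 f" "linear_on (*\<^sub>R) (*\<^sub>R) su2 g"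
      and det: "\<And>B. B \<in> su2 \<Longrightarrow> det (f B) = det B" "\<And>B. B \<in> su2 \<Longrightarrow> det (g B) = det B"
      by (auto simp: C)
    have g: "g B \<in> su2" if "B \<in> su2" for B
      using that Bij(2) by (auto dest: Bij_imp_funcset)
    have "linear_on (*\<^sub>R) (*\<^sub>R) su2 (compose su2 f g)"
      using lin g by (simp add: linear_on_def compose_def cl)
    then have "compose su2 f g \<in> ?C"
      using compose_Bij[OF Bij] det g unfolding C by (simp add: compose_eq)
    then show "f \<otimes>\<^bsub>BijGroup su2\<^esub> g \<in> ?C"
      using Bij by (simp add: BijGroup_def)
  qed
  then have "group (BijGroup su2\<lparr>carrier := ?C\<rparr>)" by (rule B.subgroup_imp_group)
  then show ?thesis by (simp add: O3_def)
qed

section \<open>The homomorphism from unitary matrices to isometries of su(2)\<close>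

lemma rho_quat:
  assumes "c = 1 \<or> c = \<i>" "w\<^sup>2 + v \<bullet> v = 1"
  shows "rho (quat c w v) (quat 1 0 u)
    = quat (c\<^sup>2) 0 ((w\<^sup>2 - v \<bullet> v) *\<^sub>R u + (2 * (v \<bullet> u)) *\<^sub>R v + (2 * w) *\<^sub>R cross3 v u)"
proof -
  have "c * cnj c = 1" using assms by auto
  note inv = matrix_inv_quat[OF this assms(2)]
  \<comment> \<open>The scalars of the outer factors cancel, and conjugation by the unit quaternion
    is the Euler-Rodrigues rotation. The determinant then contributes the sign
    \<open>c\<^sup>2\<close>.\<close>
  have "quat c w v ** quat 1 0 u ** quat (cnj c) w (- v)
    = quat (c * cnj c) 0 ((w\<^sup>2 - v \<bullet> v) *\<^sub>R u + (2 * (v \<bullet> u)) *\<^sub>R v + (2 * w) *\<^sub>R cross3 v u)"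
    by (simp add: quat_mult)
       (simp add: vec_eq_iff forall_2 forall_3 inner_real3 cross3_def complex_eq_iff power2_eq_square algebra_simps)
  then show ?thesis
    using assms by (simp add: rho_def inv quat_scale det_quat \<open>c * cnj c = 1\<close>)
qed

lemma rho_extensional: "rho A \<in> extensional su2"
  by (simp add: rho_def)

lemma rho_eqI: "(\<And>B. B \<in> su2 \<Longrightarrow> rho A B = f B) \<Longrightarrow> f \<in> extensional su2 \<Longrightarrow> rho A = f"
  using rho_extensional by (rule extensionalityI)

text \<open>With the scalar as a matrix factor, \<open>rho\<close> becomes a pure product, so that
  associativity and centrality of scalar matrices give its multiplicativity.\<close>

lemma rho_eq:
  assumes "B \<in> su2" shows "rho A B = mat (det A) ** (A ** B ** matrix_inv A)"
  using assms by (simp add: rho_def vec_eq_iff matrix_matrix_mult_def mat_def if_distrib if_distribR cong: if_cong)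

lemma rho_in_su2:
  assumes "A \<in> carrier U2pm" "B \<in> su2" shows "rho A B \<in> su2"
  using assms by (auto elim!: U2pm_cases su2E simp: rho_quat quat_uminus_scalar)

lemma mat_commute: "mat k ** A = A ** mat k" for A :: "'a::comm_semiring_1^'n^'n"
  by (simp add: vec_eq_iff matrix_matrix_mult_def mat_def if_distrib if_distribR mult.commute cong: if_cong)

lemma mat_matrix_mult_nth: "(mat a ** A) $ i $ j = a * A $ i $ j" for A :: "'a::semiring_1^'m^'n"
  by (simp add: matrix_matrix_mult_def mat_def if_distrib if_distribR cong: if_cong)

lemma mat_mult: "mat a ** mat b = (mat (a * b) :: 'a::semiring_1^'n^'n)"
  by (simp add: vec_eq_iff mat_matrix_mult_nth) (simp add: mat_def)

lemma rho_mult: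
  assumes A: "A \<in> carrier U2pm" and A': "A' \<in> carrier U2pm" and B: "B \<in> su2"
  shows "rho (A ** A') B = rho A (rho A' B)"
proof -
  have "matrix_inv (A ** A') = matrix_inv A' ** matrix_inv A"
  proof (rule matrix_inv_unique)
    have "A ** A' ** (matrix_inv A' ** matrix_inv A) = A ** (A' ** matrix_inv A') ** matrix_inv A"
      by (simp add: matrix_mul_assoc)
    then show "A ** A' ** (matrix_inv A' ** matrix_inv A) = mat 1"
      using A A' by (simp add: U2pm_invertible)
    have "matrix_inv A' ** matrix_inv A ** (A ** A') = matrix_inv A' ** (matrix_inv A ** A) ** A'"
      by (simp add: matrix_mul_assoc)
    then show "matrix_inv A' ** matrix_inv A ** (A ** A') = mat 1"
      using A A' by (simp add: U2pm_invertible)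
  qed
  then have "rho (A ** A') B
      = mat (det A) ** (mat (det A') ** (A ** (A' ** B ** matrix_inv A') ** matrix_inv A))"
    using B by (simp only: rho_eq det_mul mat_mult[symmetric] matrix_mul_assoc)
  also have "mat (det A') ** (A ** (A' ** B ** matrix_inv A') ** matrix_inv A)
      = A ** (mat (det A') ** (A' ** B ** matrix_inv A')) ** matrix_inv A"
    by (simp only: matrix_mul_assoc mat_commute[of "det A'" A])
  finally show ?thesis
    using rho_in_su2[OF A' B] B by (simp only: rho_eq)
qed

lemma rho_one: "rho (mat 1) = (\<lambda>B\<in>su2. B)"
proof (rule rho_eqI)
  have "matrix_inv (mat 1) = (mat 1 :: complex^2^2)" by (rule matrix_inv_unique) auto
  then show "rho (mat 1) B = (\<lambda>B\<in>su2. B) B" if "B \<in> su2" for B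
    using that by (simp add: rho_eq)
qed simp

lemma rho_in_O3:
  assumes A: "A \<in> carrier U2pm" shows "rho A \<in> carrier O3"
proof -
  have "rho A \<in> Bij su2"
  proof -
    have i: "inv\<^bsub>U2pm\<^esub> A \<in> carrier U2pm" using A by simp
    have "rho A (rho (inv\<^bsub>U2pm\<^esub> A) B) = B" "rho (inv\<^bsub>U2pm\<^esub> A) (rho A B) = B" if "B \<in> su2" for B
      using that A i U2pm.l_inv[OF A] U2pm.r_inv[OF A] by (simp_all add: rho_mult[symmetric] rho_one)
    then have "bij_betw (rho A) su2 su2"
      using A i by (intro bij_betwI[where g = "rho (inv\<^bsub>U2pm\<^esub> A)"]) (auto simp: rho_in_su2)
    then show ?thesis by (simp add: Bij_def rho_extensional)
  qed
  moreover have "linear_on (*\<^sub>R) (*\<^sub>R) su2 (rho A)"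
    using A by (auto elim!: U2pm_cases su2E
        simp: linear_on_def rho_quat quat_add quat_scaleR inner_add_right cross_add_right cross_mult_right
          algebra_simps)
  moreover have "det (rho A B) = det B" if "B \<in> su2" for B
  proof -
    have "det (rho A B) = det (mat (det A) :: complex^2^2) * (det A * det (matrix_inv A)) * det B"
      using that by (simp add: rho_eq det_mul)
    also have "det A * det (matrix_inv A) = 1" using U2pm_invertible[OF A] by (metis det_mul det_I)
    also have "det (mat (det A) :: complex^2^2) = 1"
      using U2pm_det[OF A] by (auto simp: det_2 mat_def)
    finally show ?thesis by simp
  qed
  ultimately show ?thesis by (simp add: O3_def)
qed

lemma group_hom_rho: "group_hom U2pm O3 rho"
proof (intro group_hom.intro group_hom_axioms.intro group_U2pm group_O3 homI)
  fix A A' assume A: "A \<in> carrier U2pm" "A' \<in> carrier U2pm"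
  have "rho (A ** A') = compose su2 (rho A) (rho A')"
    by (rule rho_eqI) (simp_all add: compose_def rho_mult A)
  moreover have "rho A \<in> Bij su2" "rho A' \<in> Bij su2" using A[THEN rho_in_O3] by (auto simp: O3_def)
  ultimately show "rho (A \<otimes>\<^bsub>U2pm\<^esub> A') = rho A \<otimes>\<^bsub>O3\<^esub> rho A'"
    by (simp add: O3_def BijGroup_def)
qed (rule rho_in_O3)

section \<open>Lifting reflection groups\<close>

text \<open>An abstraction of \<open>rho\<close>, with \<open>z\<close> in the role of minus one.
  Preimage and image are mutually inverse because a subgroup containing \<open>z\<close> is a union
  of fibres of \<open>h\<close>, and a group generated inside \<open>T\<close> lies in the image of
  \<open>h\<close>.\<close>

lemma (in group_hom) bij_betw_preimage_reflection_subgroups: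
  assumes z: "z \<in> carrier G"
    and fibre: "\<And>x y. x \<in> carrier G \<Longrightarrow> y \<in> carrier G \<Longrightarrow> h x = h y \<longleftrightarrow> x = y \<or> x = z \<otimes> y"
    and S: "S = {s \<in> carrier G. h s \<in> T}" and T: "T \<subseteq> h ` carrier G"
    and involution: "\<And>s. s \<in> S \<Longrightarrow> s \<otimes> s = \<one>"
  shows "bij_betw (\<lambda>K. {x \<in> carrier G. h x \<in> K}) (finite_reflection_subgroups H T)
           {K \<in> finite_reflection_subgroups G S. z \<in> K}"
proof (rule bij_betwI[where g = "\<lambda>K. h ` K"])
  have hz: "h (z \<otimes> x) = h x" if "x \<in> carrier G" for x
    using fibre[of "z \<otimes> x" x] that z by simp
  show "(\<lambda>K. {x \<in> carrier G. h x \<in> K})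
    \<in> finite_reflection_subgroups H T \<rightarrow> {K \<in> finite_reflection_subgroups G S. z \<in> K}"
  proof
    fix K assume "K \<in> finite_reflection_subgroups H T"
    then obtain R where K: "subgroup K H" "finite K" and R: "R \<noteq> {}" "R \<subseteq> T" "K = generate H R"
      by (auto simp: finite_reflection_subgroups_def)
    define P where "P = {x \<in> carrier G. h x \<in> K}"
    define Q where "Q = {x \<in> carrier G. h x \<in> R}"
    have QS: "Q \<subseteq> S" "Q \<subseteq> carrier G" using R(2) by (auto simp: Q_def S)
    have hQ: "h ` Q = R" using R(2) T by (force simp: Q_def)
    \<comment> \<open>Nonemptiness of the generating set enters here: some \<open>r\<close> in
      \<open>Q\<close> is needed to write \<open>z\<close> as
      \<open>(z \<otimes> r) \<otimes> r\<close>.\<close>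
    then have "Q \<noteq> {}" using R(1) by auto
    then obtain r where r: "r \<in> Q" by blast
    have "z \<otimes> r \<in> Q" using r z hz[of r] by (simp add: Q_def del: hom_mult)
    then have "(z \<otimes> r) \<otimes> r \<in> generate G Q" using r by (blast intro: generate.eng generate.incl)
    moreover have "r \<in> carrier G" "r \<otimes> r = \<one>" using r QS involution by auto
    ultimately have zQ: "z \<in> generate G Q" using z by (simp add: G.m_assoc)
    have P: "subgroup P G"
      by (rule G.subgroupI) (auto simp: P_def subgroup.m_closed[OF K(1)] subgroup.m_inv_closed[OF K(1)]
          intro!: exI[of _ \<one>] subgroup.one_closed[OF K(1)])
    have "P = generate G Q"
    proof
      show "generate G Q \<subseteq> P"
        using P by (rule G.generate_subgroup_incl[rotated]) (auto simp: Q_def P_def R(3) intro: generate.incl)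
      show "P \<subseteq> generate G Q"
      proof
        fix x assume "x \<in> P"
        then have x: "x \<in> carrier G" "h x \<in> h ` generate G Q"
          using generate_img[OF QS(2)] by (auto simp: P_def R(3) hQ)
        then obtain y where y: "y \<in> generate G Q" "h x = h y" by auto
        moreover have "y \<in> carrier G" using y(1) QS(2) by (rule G.generate_in_carrier[rotated])
        ultimately have "x = y \<or> x = z \<otimes> y" using fibre x(1) by blast
        then show "x \<in> generate G Q" using y(1) zQ by (auto intro: generate.eng)
      qed
    qed
    moreover have "finite P"
    proof -
      \<comment> \<open>Each fibre has at most two elements, so finiteness of \<open>K\<close>
        lifts.\<close>
      have "P = (\<Union>k\<in>K. {x \<in> carrier G. h x = k})" by (auto simp: P_def)
      moreover have "finite {x \<in> carrier G. h x = k}" for k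
      proof (cases "\<exists>y\<in>carrier G. h y = k")
        case True
        then obtain y where y: "y \<in> carrier G" "k = h y" by blast
        then have "{x \<in> carrier G. h x = k} \<subseteq> {y, z \<otimes> y}" by (auto simp: fibre)
        then show ?thesis by (rule finite_subset) simp
      next
        case False
        then have "{x \<in> carrier G. h x = k} = {}" by blast
        then show ?thesis by (metis finite.emptyI)
      qed
      ultimately show ?thesis using K(2) by simp
    qed
    ultimately show "{x \<in> carrier G. h x \<in> K} \<in> {K \<in> finite_reflection_subgroups G S. z \<in> K}"
      using P zQ QS(1) \<open>Q \<noteq> {}\<close> unfolding P_def[symmetric] finite_reflection_subgroups_def by blast
  qed
  show "(\<lambda>K. h ` K) \<in> {K \<in> finite_reflection_subgroups G S. z \<in> K} \<rightarrow> finite_reflection_subgroups H T"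
  proof
    fix K assume "K \<in> {K \<in> finite_reflection_subgroups G S. z \<in> K}"
    then obtain R where K: "subgroup K G" "finite K" and R: "R \<noteq> {}" "R \<subseteq> S" "K = generate G R"
      by (auto simp: finite_reflection_subgroups_def)
    have "h ` K = generate H (h ` R)" "h ` R \<noteq> {}" "h ` R \<subseteq> T"
      using R generate_img[of R] by (auto simp: S)
    then show "h ` K \<in> finite_reflection_subgroups H T"
      using subgroup_img_is_subgroup[OF K(1)] finite_imageI[OF K(2), of h] unfolding finite_reflection_subgroups_def
      by (intro CollectI conjI exI[of _ "h ` R"]) simp_all
  qed
  show "h ` {x \<in> carrier G. h x \<in> K} = K" if K: "K \<in> finite_reflection_subgroups H T" for K
  proof -
    obtain R where "R \<subseteq> T" and "K = generate H R"
      using K by (auto simp: finite_reflection_subgroups_def)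
    moreover have "generate H R \<subseteq> h ` carrier G"
      by (rule H.generate_subgroup_incl[OF order_trans[OF \<open>R \<subseteq> T\<close> T] img_is_subgroup])
    ultimately have "K \<subseteq> h ` carrier G" by simp
    then show ?thesis by blast
  qed
  show "{x \<in> carrier G. h x \<in> h ` K} = K" if "K \<in> {K \<in> finite_reflection_subgroups G S. z \<in> K}" for K
  proof -
    have K: "subgroup K G" "z \<in> K" using that by (auto simp: finite_reflection_subgroups_def)
    have KG: "K \<subseteq> carrier G" using K(1) by (rule subgroup.subset)
    moreover have "x \<in> K" if "x \<in> carrier G" "y \<in> K" "h x = h y" for x y
      using fibre[of x y] that KG subgroup.m_closed[OF K(1) K(2)] by blast
    ultimately show ?thesis by blast
  qed
qed

section \<open>Reflections of the two spaces\<close>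

interpretation rho: group_hom U2pm O3 rho by (rule group_hom_rho)

lemma quat_eq_one: "quat 1 w v = mat 1 \<longleftrightarrow> w = 1 \<and> v = 0"
  by (simp add: quat_one[symmetric])

text \<open>A reflection squares to one. For a unit quaternion this leaves only 1 and -1, neither of
  them a reflection of a plane; with the scalar \<open>\<i>\<close> it forces the real part to
  vanish. Conversely, the form and the vector of the reflection are read off from the rank-one
  matrix \<open>1 - A\<close>.\<close>

lemma reflections_U2pm_eq: "reflections_U2pm = {quat \<i> 0 u |u. u \<bullet> u = 1}"
proof safe
  fix A assume A: "A \<in> reflections_U2pm"
  then obtain l a where lin: "linear_on (*s) (*) UNIV l" and la: "l a = 1"
    and Av: "\<And>v. A *v v = v - (2 * l v) *s a"
    by (auto simp: reflections_U2pm_def is_reflection_def)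
  have l: "l (x + y) = l x + l y" "l (c *s x) = c * l x" for x y c
    using lin by (auto simp: linear_on_def)
  have "l (v - (2 * l v) *s a) = - l v" for v
  proof -
    have "v - (2 * l v) *s a = v + (- 2 * l v) *s a" by (simp add: vec_eq_iff)
    then show ?thesis using la by (simp only: l) simp
  qed
  then have "(A ** A) *v v = mat 1 *v v" for v
    by (simp add: matrix_vector_mul_assoc[symmetric] Av)
  then have AA: "A ** A = mat 1" by (simp add: matrix_eq)
  have "A \<in> carrier U2pm" using A by (simp add: reflections_U2pm_def)
  then obtain c w v where q: "c = 1 \<or> c = \<i>" "w\<^sup>2 + v \<bullet> v = 1" "A = quat c w v"
    by (rule U2pm_cases)
  from q(1) show "\<exists>u. A = quat \<i> 0 u \<and> u \<bullet> u = 1"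
  proof
    assume c: "c = 1"
    have "w * w - v \<bullet> v = 1" using AA c q(3) by (simp add: quat_mult quat_eq_one)
    then have "v \<bullet> v = 0" using q(2) unfolding power2_eq_square by linarith
    then have v: "v = 0" by simp
    then have "w = 1 \<or> w = -1" using q(2) by (simp add: power2_eq_1_iff)
    then show ?thesis
    proof
      assume "w = 1"
      then have "A = mat 1" using c v q(3) quat_one by simp
      then have "a = 0" using Av[of a] la by simp
      then show ?thesis using l(2)[of 0 a] la by simp
    next
      assume "w = -1"
      then have "A = - mat 1" using c v q(3) quat_one quat_uminus[of 1 1 0] by simp
      \<comment> \<open>If minus one were a reflection, every vector would be a multiple of
        \<open>a\<close>, which is impossible in dimension two.\<close>
      then have neg: "- v = v - (2 * l v) *s a" for v
        using Av[of v] by (simp add: vec_eq_iff forall_2 matrix_vector_mult_def sum_2 mat_def)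
      have *: "v = l v *s a" for v
      proof -
        have "2 *s v = v - (- v)" by (simp add: vec_eq_iff)
        also have "\<dots> = 2 *s (l v *s a)" unfolding neg[of v] by (simp add: vec_eq_iff)
        finally show ?thesis by (simp add: vec_eq_iff)
      qed
      have "a $ 2 = 0"
        using *[of "axis 1 1"] by (auto simp: vec_eq_iff forall_2 axis_def)
      then show ?thesis
        using *[of "axis 1 1"] *[of "axis 2 1"] by (auto simp: vec_eq_iff forall_2 axis_def)
    qed
  next
    assume c: "c = \<i>"
    have "quat (-1) (w * w - v \<bullet> v) ((2 * w) *\<^sub>R v) = quat 1 1 0"
      using AA c q(3) by (simp add: quat_mult quat_one scaleR_2[symmetric])
    then have "v \<bullet> v = 1 + w * w" by (simp add: quat_uminus_scalar)
    then have "w = 0" using q(2) by (simp add: power2_eq_square)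
    then show ?thesis using c q by auto
  qed
next
  fix u :: "real^3" assume u: "u \<bullet> u = 1"
  define A where "A = quat \<i> 0 u"
  define \<alpha> \<beta> \<gamma> where "\<alpha> = A$1$1" and "\<beta> = A$1$2" and "\<gamma> = A$2$1"
  note abc = \<alpha>_def[symmetric] \<beta>_def[symmetric] \<gamma>_def[symmetric]
  have A22: "A$2$2 = - \<alpha>" by (simp add: \<alpha>_def A_def complex_eq_iff)
  have \<gamma>: "\<gamma> = cnj \<beta>" by (simp add: \<beta>_def \<gamma>_def A_def complex_eq_iff)
  have eq: "\<alpha>\<^sup>2 + \<beta> * \<gamma> = 1"
    using u by (simp add: \<alpha>_def \<beta>_def \<gamma>_def A_def complex_eq_iff power2_eq_square inner_real3)
  have mv: "A *v x = (\<chi> i. if i = 1 then \<alpha> * x$1 + \<beta> * x$2 else \<gamma> * x$1 - \<alpha> * x$2)" for x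
    by (simp add: matrix_vector_mult_def sum_2 vec_eq_iff forall_2 abc A22)
  have "is_reflection (*s) UNIV ((*v) A)"
  \<comment> \<open>The general choice below divides by \<open>1 - \<alpha>\<close>. For
    \<open>\<alpha> = 1\<close> the matrix is diagonal with entries 1 and -1.\<close>
  proof (cases "\<alpha> = 1")
    case True
    then have "\<beta> = 0" "\<gamma> = 0" using eq \<gamma> by auto
    then show ?thesis unfolding is_reflection_def
      by (intro exI[of _ "\<lambda>x. x$2"] exI[of _ "axis 2 1"])
        (auto simp: linear_on_def mv vec_eq_iff forall_2 True axis_def)
  next
    case False
    \<comment> \<open>Here \<open>?a\<close> is the first column of \<open>1 - A\<close>, rescaled
      to have first entry 1, and \<open>2 * ?l x\<close> is the first entry of
      \<open>(1 - A) x\<close>.\<close>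
    let ?l = "\<lambda>x::complex^2. ((1 - \<alpha>) * x$1 - \<beta> * x$2) / 2"
    let ?a = "\<chi> i::2. if i = 1 then 1 else - \<gamma> / (1 - \<alpha>)"
    have bg: "\<beta> * \<gamma> = (1 - \<alpha>) * (1 + \<alpha>)" using eq by (simp add: power2_eq_square algebra_simps)
    have "?l ?a = 1" using False bg by simp
    moreover have "A *v x = x - (2 * ?l x) *s ?a" for x
    proof -
      define N where "N = (1 - \<alpha>) * x$1 - \<beta> * x$2"
      have "N * \<gamma> = (1 - \<alpha>) * (\<gamma> * x$1 - (1 + \<alpha>) * x$2)"
        unfolding N_def using bg by algebra
      then have "N * \<gamma> / (1 - \<alpha>) = \<gamma> * x$1 - (1 + \<alpha>) * x$2"
        using False by simp
      then have "\<gamma> * x$1 - \<alpha> * x$2 = x$2 + N * \<gamma> / (1 - \<alpha>)"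
        by (simp only:) (simp add: algebra_simps)
      moreover have "\<alpha> * x$1 + \<beta> * x$2 = x$1 - N" by (simp add: N_def algebra_simps)
      moreover have "2 * ?l x = N" by (simp add: N_def)
      ultimately show ?thesis by (simp only: mv) (simp add: vec_eq_iff forall_2)
    qed
    moreover have "linear_on (*s) (*) UNIV ?l"
      by (simp add: linear_on_def algebra_simps diff_divide_distrib add_divide_distrib)
    ultimately show ?thesis unfolding is_reflection_def by blast
  qed
  then show "quat \<i> 0 u \<in> reflections_U2pm"
    using u by (simp add: reflections_U2pm_def A_def quat_in_U2pm)
qed

lemma reflection_square: "A \<in> reflections_U2pm \<Longrightarrow> A ** A = mat 1"
  by (auto simp: reflections_U2pm_eq quat_mult quat_uminus_scalar quat_one)

lemma rho_reflection:
  assumes "a \<bullet> a = 1"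
  shows "rho (quat \<i> 0 a) (quat 1 0 u) = quat 1 0 (u - (2 * (a \<bullet> u)) *\<^sub>R a)"
  using assms by (simp add: rho_quat quat_uminus_scalar)

text \<open>Invariance of the norm forces the linear form of a reflection to be
  \<open>u \<bullet> a / (a \<bullet> a)\<close>. So the reflection is orthogonal, and
  \<open>rho_reflection\<close> produces it from the unit vector along \<open>a\<close>.\<close>

lemma reflections_O3_eq: "reflections_O3 = rho ` reflections_U2pm"
proof safe
  fix f assume f: "f \<in> reflections_O3"
  then obtain l B where lin: "linear_on (*\<^sub>R) (*) su2 l" and B: "B \<in> su2" and lB: "l B = 1"
    and fv: "\<And>X. X \<in> su2 \<Longrightarrow> f X = X - (2 * l X) *\<^sub>R B"
    by (auto simp: reflections_O3_def is_reflection_def)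
  have det: "det (f X) = det X" if "X \<in> su2" for X
    using f that by (simp add: reflections_O3_def O3_def)
  have ext: "f \<in> extensional su2"
    using f by (simp add: reflections_O3_def O3_def Bij_def)
  obtain a where a: "B = quat 1 0 a" using B by (rule su2E)
  define m where "m u = l (quat 1 0 u)" for u
  have m_add: "m (u + v) = m u + m v" for u v
    using lin by (simp add: m_def linear_on_def flip: quat_add[of 1 0 _ 0, simplified])
  have ma: "m a = 1" using lB by (simp add: m_def a)
  have f_quat: "f (quat 1 0 u) = quat 1 0 (u - (2 * m u) *\<^sub>R a)" for u
    by (simp add: fv a quat_scaleR quat_diff m_def)
  have iso: "m u * (m u * (a \<bullet> a) - u \<bullet> a) = 0" for u
  proof -
    have "(u - (2 * m u) *\<^sub>R a) \<bullet> (u - (2 * m u) *\<^sub>R a) = u \<bullet> u"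
      using det[of "quat 1 0 u"] by (simp only: f_quat quat_in_su2 det_quat) (simp del: of_real_add of_real_mult)
    then show ?thesis by (simp add: algebra_simps inner_commute)
  qed
  have m: "m u * (a \<bullet> a) = u \<bullet> a" for u
  proof (cases "m u = 0")
    case True
    \<comment> \<open>Where \<open>m u = 0\<close> the isometry identity says nothing about
      \<open>u \<bullet> a\<close>; at \<open>u + a\<close> the form has value 1 and the identity
      gives \<open>u \<bullet> a = 0\<close>.\<close>
    then show ?thesis using iso[of "u + a"] by (simp add: m_add ma inner_add_left)
  next
    case False
    then show ?thesis using iso[of u] by simp
  qed
  have "a \<noteq> 0" using m_add[of 0 0] ma by auto
  define s where "s = norm a"
  have s: "s > 0" "a \<bullet> a = s * s" using \<open>a \<noteq> 0\<close> by (simp_all add: s_def norm_eq_sqrt_inner)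
  define b where "b = (1 / s) *\<^sub>R a"
  have b: "b \<bullet> b = 1" using s by (simp add: b_def)
  have "rho (quat \<i> 0 b) = f"
  proof (rule rho_eqI[OF _ ext])
    fix X assume "X \<in> su2"
    then obtain u where X: "X = quat 1 0 u" by (rule su2E)
    have "(2 * (b \<bullet> u)) *\<^sub>R b = (2 * m u) *\<^sub>R a"
      using m[of u] s by (simp add: b_def inner_commute divide_simps)
    then show "rho (quat \<i> 0 b) X = f X" by (simp add: X rho_reflection[OF b] f_quat)
  qed
  moreover have "quat \<i> 0 b \<in> reflections_U2pm" using b by (auto simp: reflections_U2pm_eq)
  ultimately show "f \<in> rho ` reflections_U2pm" by blast
next
  fix A assume A: "A \<in> reflections_U2pm"
  then obtain a where a: "a \<bullet> a = 1" "A = quat \<i> 0 a" by (auto simp: reflections_U2pm_eq)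
  \<comment> \<open>The linear form has to be given on matrices, so \<open>c\<close> recovers the
    vector from the imaginary quaternion.\<close>
  define c where "c X = (THE u. X = quat 1 0 u)" for X
  have c: "c (quat 1 0 u) = u" for u by (simp add: c_def)
  have "is_reflection (*\<^sub>R) su2 (rho A)" unfolding is_reflection_def
    by (rule exI[of _ "\<lambda>X. a \<bullet> c X"], rule exI[of _ "quat 1 0 a"])
      (auto elim!: su2E simp: linear_on_def quat_add quat_scaleR quat_diff c a rho_reflection inner_add_right)
  moreover have "A \<in> carrier U2pm" using A by (simp add: reflections_U2pm_def)
  ultimately show "rho A \<in> reflections_O3" by (simp add: reflections_O3_def rho_in_O3)
qed

section \<open>The kernel and the fibres of \<open>rho\<close>\<close>

lemma rho_eq_id_iff:
  assumes "A \<in> carrier U2pm"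
  shows "rho A = rho (mat 1) \<longleftrightarrow> A = mat 1 \<or> A = - mat 1"
proof
  assume id: "rho A = rho (mat 1)"
  obtain c w v where q: "c = 1 \<or> c = \<i>" "w\<^sup>2 + v \<bullet> v = 1" "A = quat c w v"
    using assms by (rule U2pm_cases)
  \<comment> \<open>These are the diagonal entries of \<open>rho A\<close> in the standard basis;
    the cross product is orthogonal to \<open>u\<close> and drops out.\<close>
  have *: "Re (c\<^sup>2) * (w\<^sup>2 - v \<bullet> v + 2 * (v$i)\<^sup>2) = 1" for i
  proof -
    define u :: "real^3" where "u = axis i 1"
    have "quat (c\<^sup>2) 0 ((w\<^sup>2 - v \<bullet> v) *\<^sub>R u + (2 * (v \<bullet> u)) *\<^sub>R v + (2 * w) *\<^sub>R cross3 v u) = quat 1 0 u"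
      using fun_cong[OF id, of "quat 1 0 u"] q by (simp add: rho_quat rho_one)
    then have "Re (c\<^sup>2) *\<^sub>R ((w\<^sup>2 - v \<bullet> v) *\<^sub>R u + (2 * (v \<bullet> u)) *\<^sub>R v + (2 * w) *\<^sub>R cross3 v u) = u"
      using q(1) by (auto simp: quat_uminus_scalar)
    then have "(Re (c\<^sup>2) *\<^sub>R ((w\<^sup>2 - v \<bullet> v) *\<^sub>R u + (2 * (v \<bullet> u)) *\<^sub>R v + (2 * w) *\<^sub>R cross3 v u)) \<bullet> u = u \<bullet> u"
      by simp
    moreover have "u \<bullet> u = 1" "v \<bullet> u = v$i" by (simp_all add: u_def inner_axis)
    ultimately show ?thesis by (simp add: inner_add_left dot_cross_self power2_eq_square mult.assoc)
  qed
  have "c = 1 \<and> v \<bullet> v = 0"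
    using q(1)
  proof
    assume "c = 1"
    then have "w\<^sup>2 - v \<bullet> v + 2 * (v$i)\<^sup>2 = 1" for i using *[of i] by simp
    from this[of 1] this[of 2] this[of 3] show ?thesis
      using q(2) \<open>c = 1\<close> unfolding inner_real3 power2_eq_square by linarith
  next
    \<comment> \<open>This case is contradictory: the three equations add up to trace 3, while the
      negative of a rotation has trace \<open>1 - 4 * w\<^sup>2\<close>, at most 1.\<close>
    assume "c = \<i>"
    then have "- (w\<^sup>2 - v \<bullet> v + 2 * (v$i)\<^sup>2) = 1" for i using *[of i] by simp
    from this[of 1] this[of 2] this[of 3] show ?thesis
      using q(2) zero_le_power2[of w] unfolding inner_real3 power2_eq_square by linarith
  qed
  then have "c = 1" "v = 0" by auto
  moreover from this have "w = 1 \<or> w = -1" using q(2) by (simp add: power2_eq_1_iff)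
  ultimately show "A = mat 1 \<or> A = - mat 1"
    using q(3) by (auto simp: quat_one[symmetric] quat_uminus)
next
  have "rho (- mat 1) = rho (mat 1)"
  proof (rule rho_eqI)
    fix B assume "B \<in> su2"
    then obtain u where "B = quat 1 0 u" by (rule su2E)
    then show "rho (- mat 1) B = rho (mat 1) B"
      by (simp add: rho_one quat_one[symmetric] quat_uminus rho_quat)
  qed (rule rho_extensional)
  then show "A = mat 1 \<or> A = - mat 1 \<Longrightarrow> rho A = rho (mat 1)" by auto
qed

lemma minus_one_in_U2pm: "- mat 1 \<in> carrier U2pm"
  by (simp add: quat_one[symmetric] quat_uminus quat_in_U2pm)

lemma minus_one_mult: "- mat 1 ** A = - A" for A :: "'a::ring_1^'n^'n"
  by (simp add: vec_eq_iff matrix_matrix_mult_def mat_def sum_negf if_distrib if_distribR cong: if_cong)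

lemma rho_eq_iff:
  assumes A: "A \<in> carrier U2pm" and A': "A' \<in> carrier U2pm"
  shows "rho A = rho A' \<longleftrightarrow> A = A' \<or> A = - A'"
proof -
  have "rho A = rho A' \<longleftrightarrow> rho (A \<otimes>\<^bsub>U2pm\<^esub> inv\<^bsub>U2pm\<^esub> A') = rho (mat 1)"
    using A A' rho.hom_one rho.H.inv_equality[of "rho A" "inv\<^bsub>O3\<^esub> rho A'"]
    by (metis U2pm.inv_closed U2pm_simps(2) rho.H.inv_closed rho.H.inv_inv rho.H.r_inv rho.hom_closed rho.hom_inv rho.hom_mult)
  also have "\<dots> \<longleftrightarrow> A \<otimes>\<^bsub>U2pm\<^esub> inv\<^bsub>U2pm\<^esub> A' = mat 1 \<or> A \<otimes>\<^bsub>U2pm\<^esub> inv\<^bsub>U2pm\<^esub> A' = - mat 1"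
    using A A' by (intro rho_eq_id_iff) (rule U2pm.m_closed; simp)
  also have "\<dots> \<longleftrightarrow> A = A' \<or> A = - A'"
    using A A' U2pm.inv_solve_right'[of "mat 1" A A'] U2pm.inv_solve_right'[of "- mat 1" A A'] minus_one_in_U2pm U2pm.one_closed
    by (simp add: minus_one_mult)
  finally show ?thesis .
qed

text \<open>The abstract correspondence applies with \<open>z\<close> as minus one. Everything above
  a reflection of su(2) is a reflection, because the negative of a reflection in \<open>U2pm\<close>
  is again one.\<close>

lemma bij_betw_preimage_rho:
  "bij_betw (\<lambda>G. {A \<in> carrier U2pm. rho A \<in> G})
     (finite_reflection_subgroups O3 reflections_O3)
     {H \<in> finite_reflection_subgroups U2pm reflections_U2pm. - mat 1 \<in> H}"
proof (rule rho.bij_betw_preimage_reflection_subgroups)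
  have carrier: "reflections_U2pm \<subseteq> carrier U2pm" by (auto simp: reflections_U2pm_def)
  have uminus: "- A \<in> reflections_U2pm" if "A \<in> reflections_U2pm" for A
    using that unfolding reflections_U2pm_eq
    by (auto simp: quat_uminus)
  show "reflections_U2pm = {A \<in> carrier U2pm. rho A \<in> reflections_O3}"
    using carrier uminus unfolding reflections_O3_eq by (auto simp: rho_eq_iff subset_iff)
  show "reflections_O3 \<subseteq> rho ` carrier U2pm" using carrier unfolding reflections_O3_eq by blast
qed (simp_all add: minus_one_in_U2pm rho_eq_iff minus_one_mult reflection_square)

section \<open>Reflection groups without minus one\<close>

text \<open>Quaternions as pairs, matching the matrix product of \<open>quat 1\<close> by
  \<open>quat_mult\<close>. Real and imaginary parts become projections, and sums over a finite
  group can be formed in a real vector space where multiplication is linear.\<close>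

definition qmul :: "real \<times> (real^3) \<Rightarrow> real \<times> (real^3) \<Rightarrow> real \<times> (real^3)" where
  "qmul p q = (fst p * fst q - snd p \<bullet> snd q,
     fst p *\<^sub>R snd q + fst q *\<^sub>R snd p + cross3 (snd p) (snd q))"

text \<open>The rotation \<open>u \<mapsto> p u p\<^sup>-\<^sup>1\<close> of the imaginary quaternions, for \<open>p\<close> of norm one.\<close>

definition rot :: "real \<times> (real^3) \<Rightarrow> real^3 \<Rightarrow> real^3" where
  "rot p u = ((fst p)\<^sup>2 - snd p \<bullet> snd p) *\<^sub>R u + (2 * (snd p \<bullet> u)) *\<^sub>R snd p
     + (2 * fst p) *\<^sub>R cross3 (snd p) u"

lemma rot_qmul: "rot (qmul p q) u = rot p (rot q u)"
  by (simp add: rot_def qmul_def vec_eq_iff forall_3 inner_real3 cross3_def power2_eq_square algebra_simps)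

lemma linear_rot: "linear (rot p)"
  by (rule linearI) (simp_all add: rot_def inner_add_right cross_add_right cross_mult_right algebra_simps)

lemma linear_cross3: "linear (cross3 a)"
  by (rule linearI) (simp_all add: cross_add_right cross_mult_right)

lemma cross3_norm: "cross3 v c \<bullet> cross3 v c = (v \<bullet> v) * (c \<bullet> c) - (v \<bullet> c)\<^sup>2"
  by (simp add: inner_real3 cross3_def power2_eq_square algebra_simps)

lemma cross3_eq_0D:
  assumes "cross3 u v = 0"
  shows "(u \<bullet> u) *\<^sub>R v = (u \<bullet> v) *\<^sub>R u"
  using assms Lagrange[of u u v] by simp

text \<open>For \<open>c = cross3 v u\<close>, being fixed means
  \<open>cross3 v c = - (w *\<^sub>R c)\<close>, and pairing with \<open>c\<close> gives
  \<open>w = 0\<close> or \<open>c = 0\<close>. If \<open>w = 0\<close>, then \<open>v\<close> is a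
  unit vector orthogonal to \<open>c\<close>, so \<open>cross3 v c\<close> has the length of
  \<open>c\<close> but vanishes.\<close>

lemma rot_fixed_imp_cross3_eq_0:
  assumes unit: "(fst p)\<^sup>2 + snd p \<bullet> snd p = 1" and fixed: "rot p u = u"
  shows "cross3 (snd p) u = 0"
proof -
  obtain w v where p: "p = (w, v)" by (cases p)
  define c where "c = cross3 v u"
  have w: "w\<^sup>2 = 1 - v \<bullet> v" using unit by (simp add: p)
  have "2 *\<^sub>R (cross3 v c + w *\<^sub>R c) = rot p u - u"
    by (simp add: c_def Lagrange rot_def p w algebra_simps)
  then have vc: "cross3 v c = - (w *\<^sub>R c)" using fixed by (simp add: add_eq_0_iff2)
  have "cross3 v c \<bullet> c = 0" by (simp add: dot_cross_self)
  then have "w * (c \<bullet> c) = 0" by (simp add: vc)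
  then consider "w = 0" | "c \<bullet> c = 0" by auto
  then have "c \<bullet> c = 0"
  proof cases
    case 1
    then have "(v \<bullet> v) * (c \<bullet> c) = (v \<bullet> c)\<^sup>2"
      using cross3_norm[of v c] by (simp add: vc)
    moreover have "v \<bullet> c = 0" by (simp add: c_def dot_cross_self)
    ultimately show ?thesis using 1 w by auto
  qed
  then show ?thesis by (simp add: c_def p)
qed

lemma qmul_norm:
  "(fst (qmul p q))\<^sup>2 + snd (qmul p q) \<bullet> snd (qmul p q)
     = ((fst p)\<^sup>2 + snd p \<bullet> snd p) * ((fst q)\<^sup>2 + snd q \<bullet> snd q)"
  unfolding qmul_def fst_conv snd_conv by (rule quat_norm_mult)

lemma qmul_diff_right: "qmul p (q - q') = qmul p q - qmul p q'"
proof -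
  have "cross3 a (b - c) = cross3 a b - cross3 a c" for a b c
    using linear_diff[OF linear_cross3] .
  then show ?thesis by (simp add: qmul_def prod_eq_iff inner_diff_right algebra_simps)
qed

lemma finite_quaternion_group_axis:
  assumes fin: "finite K" and one: "(1, 0) \<in> K" and neg: "(-1, 0) \<notin> K"
    and unit: "\<And>p. p \<in> K \<Longrightarrow> (fst p)\<^sup>2 + snd p \<bullet> snd p = 1"
    and mult: "\<And>p q. p \<in> K \<Longrightarrow> q \<in> K \<Longrightarrow> qmul p q \<in> K"
    and inverse: "\<And>p. p \<in> K \<Longrightarrow> (fst p, - snd p) \<in> K"
  obtains b where "b \<bullet> b = 1" "\<And>p. p \<in> K \<Longrightarrow> cross3 (snd p) b = 0"
proof (cases "K = {(1, 0)}")
  case True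
  have "axis 1 1 \<bullet> (axis 1 1 :: real^3) = 1" by (simp add: inner_axis_axis)
  then show thesis by (rule that) (simp add: True)
next
  case False
  then obtain g where g: "g \<in> K" "g \<noteq> (1, 0)" using one by auto
  have bij_left: "bij_betw (qmul p) K K" if p: "p \<in> K" for p
  proof -
    \<comment> \<open>The product of \<open>p\<close> and \<open>q - q'\<close> is zero, so
      multiplicativity of the norm gives \<open>q = q'\<close>.\<close>
    have "q = q'" if "qmul p q = qmul p q'" for q q'
    proof -
      have "qmul p (q - q') = 0" using that by (simp add: qmul_diff_right)
      then have "(fst (q - q'))\<^sup>2 + snd (q - q') \<bullet> snd (q - q') = 0"
        using qmul_norm[of p "q - q'"] unit[OF p] by simp
      then have "fst (q - q') = 0 \<and> snd (q - q') = 0"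
        by (simp add: add_nonneg_eq_0_iff)
      then show ?thesis by (simp add: prod_eq_iff)
    qed
    then have "inj_on (qmul p) K" by (auto simp: inj_on_def)
    moreover have "qmul p ` K \<subseteq> K" using mult[OF p] by blast
    ultimately show ?thesis using fin by (simp add: bij_betw_def endo_inj_surj)
  qed
  have bij_square: "bij_betw (\<lambda>p. qmul p p) K K"
  proof -
    have "p = q" if p: "p \<in> K" and q: "q \<in> K" and eq: "qmul p p = qmul q q" for p q
    proof -
      define w v x y where "w = fst p" and "v = snd p" and "x = fst q" and "y = snd q"
      have pq: "p = (w, v)" "q = (x, y)" by (simp_all add: w_def v_def x_def y_def)
      have uv: "w\<^sup>2 + v \<bullet> v = 1" "x\<^sup>2 + y \<bullet> y = 1" using unit[OF p] unit[OF q] by (simp_all add: pq)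
      have e: "w * w - v \<bullet> v = x * x - y \<bullet> y" "(2 * w) *\<^sub>R v = (2 * x) *\<^sub>R y"
        using eq by (simp_all add: qmul_def pq flip: scaleR_add_left)
      have "w * w = x * x" using e(1) uv unfolding power2_eq_square by linarith
      \<comment> \<open>Equal squares have real parts equal up to sign. If both vanish, the square
        is minus one; if they are nonzero and opposite, \<open>p\<close> is the negative of
        \<open>q\<close>, and \<open>p\<close> times the inverse of \<open>q\<close> is minus
        one.\<close>
      then consider "w = 0" "x = 0" | "w \<noteq> 0" "x = w" | "w \<noteq> 0" "x = - w"
        by (cases "w = 0") (auto simp: square_eq_iff)
      then show "p = q"
      proof cases
        case 1
        then have "qmul p p = (-1, 0)" using uv by (simp add: qmul_def pq)
        then show ?thesis using mult[OF p p] neg by simp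
      next
        case 2
        then show ?thesis using e(2) by (simp add: pq)
      next
        case 3
        then have "(2 * w) *\<^sub>R v = (2 * w) *\<^sub>R (- y)" using e(2) by simp
        then have "v = - y" by (rule scaleR_left_imp_eq[rotated]) (use 3 in simp)
        then have "qmul p (x, - y) = (-1, 0)"
          using 3 uv by (simp add: qmul_def pq power2_eq_square)
        then show ?thesis using mult[OF p inverse[OF q]] neg by (simp add: pq)
      qed
    qed
    then have "inj_on (\<lambda>p. qmul p p) K" by (auto simp: inj_on_def)
    moreover have "(\<lambda>p. qmul p p) ` K \<subseteq> K" using mult by blast
    ultimately show ?thesis using fin by (simp add: bij_betw_def endo_inj_surj)
  qed
  define S where "S = (\<Sum>p\<in>K. p)"
  have "qmul g S = S"
  proof -
    have "linear (qmul g)"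
      by (rule linearI) (simp_all add: qmul_def inner_add_right cross_add_right cross_mult_right algebra_simps)
    then have "qmul g S = (\<Sum>p\<in>K. qmul g p)" unfolding S_def by (rule linear_sum)
    also have "\<dots> = S" unfolding S_def by (rule sum.reindex_bij_betw[OF bij_left[OF g(1)], of "\<lambda>p. p"])
    finally show ?thesis .
  qed
  \<comment> \<open>Since \<open>g - 1\<close> is not zero, the norm identity makes
    \<open>S\<close>, and with it its real part, vanish.\<close>
  then have "qmul (fst g - 1, snd g) S = 0" by (simp add: qmul_def prod_eq_iff algebra_simps)
  then have "((fst g - 1)\<^sup>2 + snd g \<bullet> snd g) * ((fst S)\<^sup>2 + snd S \<bullet> snd S) = 0"
    using qmul_norm[of "(fst g - 1, snd g)" S] by simp
  moreover have "(fst g - 1)\<^sup>2 + snd g \<bullet> snd g \<noteq> 0"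
    using g(2) by (simp add: add_nonneg_eq_0_iff prod_eq_iff)
  ultimately have "fst S = 0" by (simp add: add_nonneg_eq_0_iff)
  then have sum_fst: "(\<Sum>p\<in>K. fst p) = 0" by (simp add: S_def fst_sum)
  have sum_sq: "(\<Sum>p\<in>K. 2 * (fst p)\<^sup>2 - 1) = 0"
  proof -
    have "(\<Sum>p\<in>K. 2 * (fst p)\<^sup>2 - 1) = (\<Sum>p\<in>K. fst (qmul p p))"
      using unit by (intro sum.cong) (auto simp: qmul_def power2_eq_square algebra_simps)
    also have "\<dots> = (\<Sum>p\<in>K. fst p)" by (rule sum.reindex_bij_betw[OF bij_square, of fst])
    finally show ?thesis using sum_fst by simp
  qed
  \<comment> \<open>A sum of rotations over the whole group is fixed by the group; it remains to
    find a nonzero value.\<close>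
  define T where "T u = (\<Sum>p\<in>K. rot p u)" for u
  have T_fixed: "rot p (T u) = T u" if "p \<in> K" for p u
  proof -
    have "rot p (T u) = (\<Sum>q\<in>K. rot (qmul p q) u)"
      by (simp add: T_def linear_sum[OF linear_rot] rot_qmul)
    also have "\<dots> = T u"
      unfolding T_def by (rule sum.reindex_bij_betw[OF bij_left[OF that], of "\<lambda>q. rot q u"])
    finally show ?thesis .
  qed
  let ?e = "\<lambda>i. axis i 1 :: real^3"
  have "\<exists>i. T (?e i) \<noteq> 0"
  proof (rule ccontr)
    assume "\<not> ?thesis"
    then have "0 = (\<Sum>i\<in>UNIV. T (?e i) \<bullet> ?e i)" by simp
    also have "\<dots> = (\<Sum>p\<in>K. \<Sum>i\<in>UNIV. rot p (?e i) \<bullet> ?e i)"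
      unfolding T_def inner_sum_left by (rule sum.swap)
    \<comment> \<open>The trace \<open>4 * (fst p)\<^sup>2 - 1\<close> of a rotation is split so
      that \<open>sum_sq\<close> cancels everything but the constant 1.\<close>
    also have "\<dots> = (\<Sum>p\<in>K. 2 * (2 * (fst p)\<^sup>2 - 1) + 1)"
    proof (rule sum.cong)
      fix p assume p: "p \<in> K"
      have "rot p (?e i) \<bullet> ?e i = (fst p)\<^sup>2 - snd p \<bullet> snd p + 2 * (snd p $ i)\<^sup>2" for i
      proof -
        define a where "a = ?e i"
        have "a \<bullet> a = 1" "snd p \<bullet> a = snd p $ i" by (simp_all add: a_def inner_axis)
        then have "rot p a \<bullet> a = (fst p)\<^sup>2 - snd p \<bullet> snd p + 2 * (snd p $ i)\<^sup>2"
          by (simp add: rot_def inner_add_left dot_cross_self power2_eq_square)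
        then show ?thesis by (simp only: a_def)
      qed
      then have "(\<Sum>i\<in>UNIV. rot p (?e i) \<bullet> ?e i) = 3 * (fst p)\<^sup>2 - snd p \<bullet> snd p"
        by (simp add: sum_3 inner_real3 power2_eq_square)
      then show "(\<Sum>i\<in>UNIV. rot p (?e i) \<bullet> ?e i) = 2 * (2 * (fst p)\<^sup>2 - 1) + 1"
        using unit[OF p] by simp
    qed simp
    also have "\<dots> = card K"
      unfolding sum.distrib sum_distrib_left[symmetric] sum_sq by simp
    finally show False using fin one by auto
  qed
  then obtain i where i: "T (?e i) \<noteq> 0" by blast
  show thesis
  proof (rule that[of "(1 / norm (T (?e i))) *\<^sub>R T (?e i)"])
    show "(1 / norm (T (?e i))) *\<^sub>R T (?e i) \<bullet> (1 / norm (T (?e i))) *\<^sub>R T (?e i) = 1"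
      using i by (simp add: power2_norm_eq_inner[symmetric] power2_eq_square)
    show "cross3 (snd p) ((1 / norm (T (?e i))) *\<^sub>R T (?e i)) = 0" if "p \<in> K" for p
      using rot_fixed_imp_cross3_eq_0[OF unit[OF that] T_fixed[OF that]] by (simp add: cross_mult_right)
  qed
qed

text \<open>Multiplication by \<open>z\<close> permutes \<open>Z\<close>, so comparing the products
  over \<open>Z\<close> gives \<open>z ^ card Z = 1\<close>. There are exactly \<open>card Z\<close>
  such roots, hence equality.\<close>

lemma finite_mult_closed_eq_roots_unity:
  fixes Z :: "complex set"
  assumes fin: "finite Z" and "0 \<notin> Z" "1 \<in> Z" and mult: "\<And>x y. x \<in> Z \<Longrightarrow> y \<in> Z \<Longrightarrow> x * y \<in> Z"
  shows "Z = {z. z ^ card Z = 1}"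
proof (rule card_subset_eq)
  have "card Z > 0" using assms by (auto simp: card_gt_0_iff)
  then show "finite {z::complex. z ^ card Z = 1}" "card Z = card {z::complex. z ^ card Z = 1}"
    by (simp_all add: finite_roots_unity card_roots_unity_eq)
  show "Z \<subseteq> {z. z ^ card Z = 1}"
  proof
    fix z assume z: "z \<in> Z"
    have "z \<noteq> 0" using z assms by auto
    then have "inj_on ((*) z) Z" by (auto simp: inj_on_def)
    then have "bij_betw ((*) z) Z Z"
      using fin mult z by (simp add: bij_betw_def endo_inj_surj image_subset_iff)
    then have "(\<Prod>x\<in>Z. z * x) = (\<Prod>x\<in>Z. x)" by (rule prod.reindex_bij_betw[where g = "\<lambda>x. x"])
    moreover have "(\<Prod>x\<in>Z. z * x) = z ^ card Z * (\<Prod>x\<in>Z. x)" by (simp add: prod.distrib)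
    moreover have "(\<Prod>x\<in>Z. x) \<noteq> 0" using assms by (auto simp: prod_zero_iff)
    ultimately show "z \<in> {z. z ^ card Z = 1}" by simp
  qed
qed

text \<open>For a unit vector \<open>b\<close> this embeds the complex numbers into the quaternions
  with \<open>b\<close> as imaginary unit.\<close>

definition cquat :: "real^3 \<Rightarrow> complex \<Rightarrow> complex^2^2" where
  "cquat b z = quat 1 (Re z) (Im z *\<^sub>R b)"

lemma cquat_mult: "b \<bullet> b = 1 \<Longrightarrow> cquat b z ** cquat b z' = cquat b (z * z')"
  by (simp add: cquat_def quat_mult algebra_simps cross_mult_left cross_mult_right flip: scaleR_add_left)

lemma cquat_one: "cquat b 1 = mat 1"
  by (simp add: cquat_def quat_one)

lemma cquat_minus_one: "cquat b (- 1) = - mat 1"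
  by (simp add: cquat_def quat_uminus flip: quat_one)

lemma cquat_inject: "b \<bullet> b = 1 \<Longrightarrow> cquat b z = cquat b z' \<longleftrightarrow> z = z'"
  by (auto simp: cquat_def complex_eq_iff)

lemma cquat_in_U2pm: "b \<bullet> b = 1 \<Longrightarrow> cmod z = 1 \<Longrightarrow> cquat b z \<in> carrier U2pm"
  unfolding cquat_def by (rule quat_in_U2pm) (auto simp: cmod_def power2_eq_square)

text \<open>Orthogonal imaginary quaternions anticommute. On the unit circle, where conjugation is
  inversion, this is the dihedral relation.\<close>

lemma reflection_cquat:
  assumes "b \<bullet> u = 0"
  shows "quat \<i> 0 u ** cquat b z = cquat b (cnj z) ** quat \<i> 0 u"
  using assms cross_skew[of u b]
  by (simp add: cquat_def quat_mult inner_commute cross_mult_left cross_mult_right)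

lemma cquat_reflection:
  assumes "b \<bullet> u = 0"
  shows "cquat b z ** quat \<i> 0 u = quat \<i> 0 (Re z *\<^sub>R u + Im z *\<^sub>R cross3 b u)"
  using assms by (simp add: cquat_def quat_mult cross_mult_left)

text \<open>The vectors \<open>u\<close> and \<open>cross3 b u\<close> are orthonormal, so the
  vector in \<open>cquat_reflection\<close> has norm one.\<close>

lemma cquat_reflection_in_reflections:
  assumes "b \<bullet> b = 1" "u \<bullet> u = 1" "b \<bullet> u = 0" "cmod z = 1"
  shows "cquat b z ** quat \<i> 0 u \<in> reflections_U2pm"
proof -
  have "(Re z)\<^sup>2 + (Im z)\<^sup>2 = 1" using assms(4) by (simp add: cmod_def)
  then have "(Re z *\<^sub>R u + Im z *\<^sub>R cross3 b u) \<bullet> (Re z *\<^sub>R u + Im z *\<^sub>R cross3 b u) = 1"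
    using assms(1-3)
    by (simp add: inner_add_left inner_add_right dot_cross_self cross3_norm power2_eq_square)
  then show ?thesis using assms(3) by (auto simp: cquat_reflection reflections_U2pm_eq)
qed

section \<open>Dihedral groups of unitary matrices\<close>

definition dihedral_rep :: "real^3 \<Rightarrow> real^3 \<Rightarrow> nat \<Rightarrow> int \<times> int \<Rightarrow> complex^2^2" where
  "dihedral_rep b u n = (\<lambda>(i, e). cquat b (cis (2 * pi / n) powi i)
     ** (if e = 1 then mat 1 else quat \<i> 0 u))"

definition dihedral_image :: "real^3 \<Rightarrow> real^3 \<Rightarrow> nat \<Rightarrow> (complex^2^2) set" where
  "dihedral_image b u n = (\<Union>z\<in>{z. z ^ n = 1}. {cquat b z, cquat b z ** quat \<i> 0 u})"

lemma bij_betw_powi_roots_unity: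
  assumes "n > 0"
  shows "bij_betw (\<lambda>i. cis (2 * pi / n) powi i) {0..<int n} {z. z ^ n = 1}"
proof -
  have "bij_betw nat {0..<int n} {..<n}"
    by (rule bij_betwI[where g = int]) auto
  from bij_betw_trans[OF this Complex.bij_betw_roots_unity[OF assms]]
  show ?thesis
    by (rule bij_betw_cong[THEN iffD1, rotated])
      (auto simp: power_int_def Complex.DeMoivre algebra_simps)
qed

lemma dihedral_rep_image:
  assumes "n > 0"
  shows "dihedral_rep b u n ` carrier (dihedral n) = dihedral_image b u n"
proof -
  have *: "(\<lambda>i. cis (2 * pi / n) powi i) ` {0..<int n} = {z. z ^ n = 1}"
    using bij_betw_powi_roots_unity[OF assms] by (simp add: bij_betw_def)
  have "dihedral_image b u n = (\<Union>i\<in>{0..<int n}.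
      {cquat b (cis (2 * pi / n) powi i), cquat b (cis (2 * pi / n) powi i) ** quat \<i> 0 u})"
    unfolding dihedral_image_def by (simp flip: *)
  moreover have "carrier (dihedral n) = (\<Union>i\<in>{0..<int n}. {(i, 1), (i, - 1)})"
    by (auto simp: dihedral_def)
  ultimately show ?thesis by (simp add: image_UN dihedral_rep_def)
qed

lemma dihedral_rep_hom:
  assumes b: "b \<bullet> b = 1" and u: "u \<bullet> u = 1" and bu: "b \<bullet> u = 0" and n: "n > 0"
  shows "group_hom (dihedral n) U2pm (dihedral_rep b u n)"
proof (intro group_hom.intro group_hom_axioms.intro group_dihedral group_U2pm homI n)
  define \<zeta> where "\<zeta> = cis (2 * pi / n)"
  have norm: "cmod (\<zeta> powi i) = 1" for i by (simp add: \<zeta>_def norm_power_int)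
  define s where "s = quat \<i> 0 u"
  have s: "s \<in> carrier U2pm" unfolding s_def using u by (intro quat_in_U2pm) auto
  have ss: "s ** s = mat 1" using u by (simp add: s_def quat_mult quat_uminus_scalar quat_one)
  fix x assume x: "x \<in> carrier (dihedral n)"
  then show "dihedral_rep b u n x \<in> carrier U2pm"
    using cquat_in_U2pm[OF b norm] U2pm.m_closed[OF cquat_in_U2pm[OF b norm] s]
    by (cases x) (auto simp: dihedral_rep_def s_def \<zeta>_def)
  fix y assume y: "y \<in> carrier (dihedral n)"
  have z0: "\<zeta> \<noteq> 0" by (simp add: \<zeta>_def)
  have zn: "\<zeta> ^ n = 1" using n by (simp add: \<zeta>_def Complex.DeMoivre)
  \<comment> \<open>The addition modulo \<open>n\<close> in \<open>dihedral n\<close> is invisible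
    to powers of an \<open>n\<close>-th root of unity.\<close>
  have zmod: "\<zeta> powi (i mod int n) = \<zeta> powi i" for i
  proof -
    have "\<zeta> powi (int n * (i div int n)) = 1" by (simp add: power_int_mult zn)
    moreover have "\<zeta> powi (int n * (i div int n) + i mod int n)
        = \<zeta> powi (int n * (i div int n)) * \<zeta> powi (i mod int n)"
      by (rule power_int_add) (simp add: z0)
    ultimately show ?thesis by simp
  qed
  have zcnj: "cnj (\<zeta> powi i) = \<zeta> powi (- i)" for i
    by (simp add: power_int_minus complex_cnj_power_int cis_cnj \<zeta>_def flip: cis_inverse power_int_inverse)
  obtain i e where x': "x = (i, e)" "e = 1 \<or> e = - 1" using x by (auto simp: dihedral_def)
  obtain j t where y': "y = (j, t)" "t = 1 \<or> t = - 1" using y by (auto simp: dihedral_def)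
  have sc: "s ** cquat b (\<zeta> powi j) = cquat b (\<zeta> powi (- j)) ** s"
    using reflection_cquat[OF bu, of "\<zeta> powi j"] by (simp only: s_def zcnj)
  have cc: "cquat b (\<zeta> powi i) ** cquat b (\<zeta> powi k) = cquat b (\<zeta> powi (i + k))" for i k
    using z0 by (simp add: cquat_mult[OF b] power_int_add)
  have E: "dihedral_rep b u n (i, e) = cquat b (\<zeta> powi i) ** (if e = 1 then mat 1 else s)" for i e
    by (simp add: dihedral_rep_def s_def \<zeta>_def)
  show "dihedral_rep b u n (x \<otimes>\<^bsub>dihedral n\<^esub> y) = dihedral_rep b u n x \<otimes>\<^bsub>U2pm\<^esub> dihedral_rep b u n y"
  proof (cases "e = 1")
    case True
    then show ?thesis using y'
      by (auto simp: x'(1) dihedral_def E zmod matrix_mul_assoc cc)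
  next
    case False
    then have e: "e = -1" using x' by simp
    have "cquat b (\<zeta> powi i) ** s ** cquat b (\<zeta> powi j)
        = cquat b (\<zeta> powi i) ** (s ** cquat b (\<zeta> powi j))"
      by (simp only: matrix_mul_assoc)
    also have "\<dots> = cquat b (\<zeta> powi (i - j)) ** s"
      by (simp add: sc cc matrix_mul_assoc)
    finally have "cquat b (\<zeta> powi i) ** s ** cquat b (\<zeta> powi j) = cquat b (\<zeta> powi (i - j)) ** s" .
    moreover have "cquat b (\<zeta> powi (i - j)) ** s ** s = cquat b (\<zeta> powi (i - j))"
      by (simp add: ss flip: matrix_mul_assoc)
    ultimately show ?thesis using y'(2)
      by (auto simp: x'(1) y'(1) e dihedral_def E zmod matrix_mul_assoc)
  qed
qed

text \<open>The determinant recovers the sign component, since circle elements have determinant one.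
  Cancelling the reflection leaves a power of a primitive root of unity, which determines the
  exponent.\<close>

lemma dihedral_rep_inj:
  assumes b: "b \<bullet> b = 1" and u: "u \<bullet> u = 1" and bu: "b \<bullet> u = 0" and n: "n > 0"
  shows "inj_on (dihedral_rep b u n) (carrier (dihedral n))"
proof (rule inj_onI)
  fix x y assume x: "x \<in> carrier (dihedral n)" and y: "y \<in> carrier (dihedral n)"
    and eq: "dihedral_rep b u n x = dihedral_rep b u n y"
  obtain i e where x': "x = (i, e)" "e = 1 \<or> e = - 1" "i \<in> {0..<int n}" using x by (auto simp: dihedral_def)
  obtain j t where y': "y = (j, t)" "t = 1 \<or> t = - 1" "j \<in> {0..<int n}" using y by (auto simp: dihedral_def)
  define \<zeta> where "\<zeta> = cis (2 * pi / n)"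
  have norm: "cmod (\<zeta> powi i) = 1" for i by (simp add: \<zeta>_def norm_power_int)
  have E: "dihedral_rep b u n (i, e) = cquat b (\<zeta> powi i) ** (if e = 1 then mat 1 else quat \<i> 0 u)" for i e
    by (simp add: dihedral_rep_def \<zeta>_def)
  have "det (dihedral_rep b u n (i, e)) = e" if "e = 1 \<or> e = -1" for i e
  proof -
    have "(Re (\<zeta> powi i))\<^sup>2 + (Im (\<zeta> powi i))\<^sup>2 = 1" using norm[of i] by (simp add: cmod_def)
    then have "det (cquat b (\<zeta> powi i)) = 1" using b by (simp add: cquat_def det_quat power2_eq_square)
    then show ?thesis using that u by (auto simp: E det_mul det_quat)
  qed
  from this[OF x'(2), of i] this[OF y'(2), of j] have et: "e = t"
    using eq by (simp add: x' y')
  have "cquat b (\<zeta> powi i) = cquat b (\<zeta> powi j)"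
  proof (cases "e = 1")
    case True
    then show ?thesis using eq et by (simp add: x' y' E)
  next
    case False
    have "quat \<i> 0 u ** quat \<i> 0 u = mat 1" using u by (simp add: quat_mult quat_uminus_scalar quat_one)
    moreover have "cquat b (\<zeta> powi i) ** quat \<i> 0 u ** quat \<i> 0 u
        = cquat b (\<zeta> powi j) ** quat \<i> 0 u ** quat \<i> 0 u"
      using eq et False by (simp add: x' y' E)
    ultimately show ?thesis by (simp flip: matrix_mul_assoc)
  qed
  then have "\<zeta> powi i = \<zeta> powi j" by (simp add: cquat_inject[OF b])
  then have "i = j"
    using bij_betw_powi_roots_unity[OF n] x'(3) y'(3) unfolding \<zeta>_def by (meson bij_betw_imp_inj_on inj_onD)
  then show "x = y" by (simp add: x' y' et)
qed

lemma dihedral_image_subgroup: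
  assumes "b \<bullet> b = 1" "u \<bullet> u = 1" "b \<bullet> u = 0" "n > 0"
  shows "subgroup (dihedral_image b u n) U2pm"
    and "U2pm\<lparr>carrier := dihedral_image b u n\<rparr> \<cong> dihedral n"
proof -
  interpret D: group_hom "dihedral n" U2pm "dihedral_rep b u n" by (rule dihedral_rep_hom[OF assms])
  show "subgroup (dihedral_image b u n) U2pm"
    using D.img_is_subgroup by (simp add: dihedral_rep_image[OF assms(4)])
  have "dihedral_rep b u n \<in> iso (dihedral n) (U2pm\<lparr>carrier := dihedral_image b u n\<rparr>)"
    using D.homh dihedral_rep_inj[OF assms] dihedral_rep_image[OF assms(4)]
    by (auto simp: iso_def hom_def bij_betw_def)
  then have "dihedral n \<cong> U2pm\<lparr>carrier := dihedral_image b u n\<rparr>" by (auto simp: is_iso_def)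
  then show "U2pm\<lparr>carrier := dihedral_image b u n\<rparr> \<cong> dihedral n"
    using group.iso_sym[OF group_dihedral[OF assms(4)]] by blast
qed

lemma matrix_mult_minus_right: "A ** (- B) = - (A ** B)" for A B :: "'a::ring_1^'n^'n"
  by (simp add: vec_eq_iff matrix_matrix_mult_def sum_negf)

text \<open>All products of a circle element \<open>z\<close> with \<open>s\<close> are reflections,
  and they generate: \<open>z\<close> itself is the product of \<open>z s\<close> and
  \<open>1 s\<close>.\<close>

lemma dihedral_image_generated:
  assumes b: "b \<bullet> b = 1" and u: "u \<bullet> u = 1" and bu: "b \<bullet> u = 0" and n: "n > 0"
  shows "dihedral_image b u n \<in> finite_reflection_subgroups U2pm reflections_U2pm"
proof -
  define s where "s = quat \<i> 0 u"
  have ss: "s ** s = mat 1" using u by (simp add: s_def quat_mult quat_uminus_scalar quat_one)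
  define R where "R = (\<lambda>z. cquat b z ** s) ` {z. z ^ n = 1}"
  let ?D = "dihedral_image b u n"
  note sub = dihedral_image_subgroup(1)[OF assms]
  have D: "?D = cquat b ` {z. z ^ n = 1} \<union> R"
    unfolding dihedral_image_def R_def s_def by blast
  have "1 \<in> {z::complex. z ^ n = 1}" by simp
  then have sR: "cquat b 1 ** s \<in> R" unfolding R_def by blast
  have "?D = generate U2pm R"
  proof
    show "generate U2pm R \<subseteq> ?D"
      by (rule U2pm.generate_subgroup_incl[OF _ sub]) (simp add: D)
    have "cquat b z \<in> generate U2pm R" if "z ^ n = 1" for z
    proof -
      have "cquat b z ** s \<in> R" using that by (simp add: R_def)
      with sR have "cquat b z ** s \<otimes>\<^bsub>U2pm\<^esub> (cquat b 1 ** s) \<in> generate U2pm R"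
        by (intro generate.eng generate.incl)
      then show ?thesis by (simp add: cquat_one ss flip: matrix_mul_assoc)
    qed
    then show "?D \<subseteq> generate U2pm R" unfolding D by (auto intro: generate.incl)
  qed
  moreover have "R \<subseteq> reflections_U2pm"
  proof -
    have "cmod z = 1" if "z ^ n = 1" for z
      using that n by (metis norm_one norm_power norm_ge_zero power_eq_1_iff neq0_conv)
    then show ?thesis using cquat_reflection_in_reflections[OF b u bu] by (auto simp: R_def s_def)
  qed
  moreover have "finite ?D"
    using n by (simp add: D R_def finite_roots_unity)
  ultimately show ?thesis
    using sub sR unfolding finite_reflection_subgroups_def by blast
qed

text \<open>As a circle element, minus one would need \<open>(- 1) ^ n = 1\<close>, which fails for
  odd \<open>n\<close>. The remaining elements are reflections, and minus one is not a
  reflection.\<close>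

lemma minus_one_notin_dihedral_image:
  assumes b: "b \<bullet> b = 1" and u: "u \<bullet> u = 1" and bu: "b \<bullet> u = 0" and n: "odd n"
  shows "- mat 1 \<notin> dihedral_image b u n"
proof
  assume "- mat 1 \<in> dihedral_image b u n"
  then obtain z where z: "z ^ n = 1" and "- mat 1 = cquat b z \<or> - mat 1 = cquat b z ** quat \<i> 0 u"
    by (auto simp: dihedral_image_def)
  moreover have "- mat 1 \<noteq> cquat b z ** quat \<i> 0 u"
  proof
    assume eq: "- mat 1 = cquat b z ** quat \<i> 0 u"
    have "n > 0" using n by (auto intro: Nat.gr0I)
    then have "cmod z = 1"
      using z by (metis norm_one norm_power norm_ge_zero power_eq_1_iff neq0_conv)
    then have "- mat 1 \<in> reflections_U2pm"
      unfolding eq by (rule cquat_reflection_in_reflections[OF b u bu])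
    then show False by (auto simp: reflections_U2pm_eq vec_eq_iff forall_2 mat_def complex_eq_iff)
  qed
  ultimately have "cquat b z = cquat b (- 1)" by (simp add: cquat_minus_one)
  then have "z = -1" by (simp add: cquat_inject[OF b])
  then show False using z n by simp
qed

section \<open>Classification of the groups without minus one\<close>

lemma unit_orthogonal_exists:
  fixes u :: "real^3"
  obtains b where "b \<bullet> b = 1" "b \<bullet> u = 0"
proof -
  obtain y where y: "y \<noteq> 0" "orthogonal u y"
    using orthogonal_to_vector_exists[of u] by auto
  show thesis
  proof (rule that[of "(1 / norm y) *\<^sub>R y"])
    show "(1 / norm y) *\<^sub>R y \<bullet> (1 / norm y) *\<^sub>R y = 1"
      using y by (simp add: power2_norm_eq_inner[symmetric] power2_eq_square)
  qed (use y in \<open>simp add: orthogonal_def inner_commute\<close>)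
qed

lemma reflection_subgroup_eq_dihedral_image:
  assumes H: "H \<in> finite_reflection_subgroups U2pm reflections_U2pm" and neg: "- mat 1 \<notin> H"
  obtains b u n where "b \<bullet> b = 1" "u \<bullet> u = 1" "b \<bullet> u = 0" "odd n" "H = dihedral_image b u n"
proof -
  obtain R where sub: "subgroup H U2pm" and fin: "finite H" and R: "R \<noteq> {}" "R \<subseteq> reflections_U2pm"
    and gen: "H = generate U2pm R"
    using H by (auto simp: finite_reflection_subgroups_def)
  have RH: "R \<subseteq> H" unfolding gen by (auto intro: generate.incl)
  have HU: "H \<subseteq> carrier U2pm" using sub by (rule subgroup.subset)
  have mult: "A ** B \<in> H" if "A \<in> H" "B \<in> H" for A B
    using subgroup.m_closed[OF sub that] by simp
  have one: "mat 1 \<in> H" using subgroup.one_closed[OF sub] by simp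
  obtain s where s: "s \<in> R" using R(1) by blast
  then obtain u where su: "s = quat \<i> 0 u" and u: "u \<bullet> u = 1"
    using R(2) by (auto simp: reflections_U2pm_eq)
  have sH: "s \<in> H" using s RH by blast
  have ss: "s ** s = mat 1" using s R(2) by (auto intro: reflection_square)
  \<comment> \<open>The subgroup of determinant one in pair form, as
    \<open>finite_quaternion_group_axis\<close> takes it.\<close>
  define K where "K = {p. quat 1 (fst p) (snd p) \<in> H}"
  have K_fin: "finite K"
  proof (rule finite_imageD)
    show "finite ((\<lambda>p. quat 1 (fst p) (snd p)) ` K)"
      by (rule finite_subset[OF _ fin]) (auto simp: K_def)
  qed (auto simp: inj_on_def prod_eq_iff)
  have K_one: "(1, 0) \<in> K" using one by (simp add: K_def quat_one)
  have K_neg: "(-1, 0) \<notin> K" using neg quat_uminus[of 1 1 0] by (simp add: K_def quat_one)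
  have unit: "w\<^sup>2 + v \<bullet> v = 1" if "quat 1 w v \<in> H" for w v
  proof -
    have "quat 1 w v ** conj_transpose (quat 1 w v) = mat 1" using that HU by (auto simp: U2pm_def)
    then show ?thesis by (simp add: conj_transpose_quat quat_mult quat_eq_one power2_eq_square)
  qed
  have K_unit: "(fst p)\<^sup>2 + snd p \<bullet> snd p = 1" if "p \<in> K" for p
    using unit that by (simp add: K_def)
  have K_mult: "qmul p q \<in> K" if "p \<in> K" "q \<in> K" for p q
    using mult[of "quat 1 (fst p) (snd p)" "quat 1 (fst q) (snd q)"] that
    by (simp add: K_def quat_mult qmul_def)
  have K_inverse: "(fst p, - snd p) \<in> K" if p: "p \<in> K" for p
  proof -
    have e: "quat 1 (fst p) (- snd p) ** quat 1 (fst p) (snd p) = mat 1"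
      using quat_mult_inverse(2)[of 1 1] K_unit[OF p] by simp
    have "quat 1 (fst p) (- snd p) \<in> carrier U2pm" using K_unit[OF p] by (intro quat_in_U2pm) auto
    then have "inv\<^bsub>U2pm\<^esub> quat 1 (fst p) (snd p) = quat 1 (fst p) (- snd p)"
      using e p HU by (intro U2pm.inv_equality) (auto simp: K_def)
    then show ?thesis using subgroup.m_inv_closed[OF sub, of "quat 1 (fst p) (snd p)"] p by (simp add: K_def)
  qed
  have "\<exists>b. b \<bullet> b = 1 \<and> b \<bullet> u = 0 \<and> (\<forall>p\<in>K. cross3 (snd p) b = 0)"
  proof (cases "K = {(1, 0)}")
    case True
    \<comment> \<open>The trivial group has every axis, so one orthogonal to \<open>u\<close> is
      chosen.\<close>
    obtain b where "b \<bullet> b = 1" "b \<bullet> u = 0" by (rule unit_orthogonal_exists)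
    then show ?thesis using True by auto
  next
    case False
    obtain b where b: "b \<bullet> b = 1" and axis: "\<And>p. p \<in> K \<Longrightarrow> cross3 (snd p) b = 0"
      using finite_quaternion_group_axis[OF K_fin K_one K_neg K_unit K_mult K_inverse] by metis
    \<comment> \<open>A second reflection \<open>t\<close> yields \<open>s t \<in> K\<close>, whose imaginary part is orthogonal to \<open>u\<close> and parallel to \<open>b\<close>.\<close>
    have "\<exists>t\<in>R. t \<noteq> s"
    proof (rule ccontr)
      assume "\<not> ?thesis"
      \<comment> \<open>A single reflection generates only \<open>{mat 1, s}\<close>, whose part of
        determinant one is trivial, contrary to the case assumption.\<close>
      then have Rs: "R = {s}" using s by blast
      have "subgroup {mat 1, s} U2pm"
      proof (rule U2pm.subgroupI)
        show "{mat 1, s} \<subseteq> carrier U2pm" using one sH HU by blast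
        have "inv\<^bsub>U2pm\<^esub> s = s" using ss sH HU by (intro U2pm.inv_equality) auto
        then show "inv\<^bsub>U2pm\<^esub> a \<in> {mat 1, s}" if "a \<in> {mat 1, s}" for a
          using that U2pm.inv_one by auto
      qed (use ss in auto)
      then have H1: "H \<subseteq> {mat 1, s}"
        unfolding gen by (rule U2pm.generate_subgroup_incl[rotated]) (simp add: Rs)
      have "K \<subseteq> {(1, 0)}"
      proof
        fix p assume p: "p \<in> K"
        then have "quat 1 (fst p) (snd p) = mat 1 \<or> quat 1 (fst p) (snd p) = s"
          using H1 by (auto simp: K_def)
        moreover have "det (quat 1 (fst p) (snd p)) = 1" using K_unit[OF p] by (simp add: det_quat)
        moreover have "det s = -1" using u by (simp add: su det_quat)
        ultimately have "quat 1 (fst p) (snd p) = mat 1" by auto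
        then show "p \<in> {(1, 0)}" by (simp add: quat_eq_one prod_eq_iff)
      qed
      with False K_one show False by blast
    qed
    then obtain t where t: "t \<in> R" "t \<noteq> s" by blast
    then obtain x where tx: "t = quat \<i> 0 x" and x: "x \<bullet> x = 1"
      using R(2) by (auto simp: reflections_U2pm_eq)
    have tH: "t \<in> H" using t RH by blast
    have "x \<noteq> u" using t(2) by (simp add: tx su)
    have "x \<noteq> - u"
    proof
      assume "x = - u"
      then have "s ** t = - mat 1" using ss by (simp add: tx su matrix_mult_minus_right flip: quat_uminus[of \<i> 0, simplified])
      then show False using mult[OF sH tH] neg by simp
    qed
    define c where "c = cross3 u x"
    \<comment> \<open>Unit vectors with vanishing cross product agree up to sign, and both signs are
      excluded.\<close>
    have "c \<noteq> 0"
    proof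
      assume "c = 0"
      then have "(u \<bullet> x)\<^sup>2 = 1" using cross3_norm[of u x] u x by (simp add: c_def)
      then have "u \<bullet> x = 1 \<or> u \<bullet> x = -1" by (simp add: power2_eq_1_iff)
      then have "(u - x) \<bullet> (u - x) = 0 \<or> (u + x) \<bullet> (u + x) = 0"
        using u x by (auto simp: inner_diff_left inner_diff_right inner_add_left inner_add_right inner_commute)
      then have "x = u \<or> x = - u" by (auto simp: eq_neg_iff_add_eq_0 add.commute)
      then show False using \<open>x \<noteq> u\<close> \<open>x \<noteq> - u\<close> by blast
    qed
    have "s ** t = quat 1 (u \<bullet> x) (- c)" by (simp add: su tx quat_mult quat_uminus_scalar c_def)
    then have "(u \<bullet> x, - c) \<in> K" using mult[OF sH tH] by (simp add: K_def)
    then have "cross3 (- c) b = 0" using axis by force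
    then have "(c \<bullet> c) *\<^sub>R b = (c \<bullet> b) *\<^sub>R c" using cross3_eq_0D[of "- c" b] by simp
    then have "((c \<bullet> c) *\<^sub>R b) \<bullet> u = ((c \<bullet> b) *\<^sub>R c) \<bullet> u" by simp
    moreover have "c \<bullet> u = 0" by (simp add: c_def dot_cross_self)
    ultimately have "b \<bullet> u = 0" using \<open>c \<noteq> 0\<close> by simp
    then show ?thesis using b axis by blast
  qed
  then obtain b where b: "b \<bullet> b = 1" and bu: "b \<bullet> u = 0"
    and axis: "\<And>p. p \<in> K \<Longrightarrow> cross3 (snd p) b = 0" by blast
  \<comment> \<open>The vector \<open>v\<close> is parallel to the unit vector \<open>b\<close> with
    coordinate \<open>b \<bullet> v\<close>, so the part of determinant one lies in the circle with
    axis \<open>b\<close>.\<close>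
  have K_cquat: "quat 1 w v = cquat b (Complex w (b \<bullet> v))" if "quat 1 w v \<in> H" for w v
  proof -
    have "cross3 v b = 0" using axis[of "(w, v)"] that by (simp add: K_def)
    then have "cross3 b v = 0" using cross_skew[of b v] by simp
    then show ?thesis using cross3_eq_0D[of b v] b by (simp add: cquat_def)
  qed
  define Z where "Z = {z. cquat b z \<in> H}"
  define n where "n = card Z"
  have Z_fin: "finite Z"
  proof (rule finite_imageD)
    show "finite (cquat b ` Z)" by (rule finite_subset[OF _ fin]) (auto simp: Z_def)
  qed (simp add: inj_on_def cquat_inject[OF b])
  have Z_one: "1 \<in> Z" using one by (simp add: Z_def cquat_one)
  have "0 \<notin> Z" using unit[of 0 0] by (auto simp: Z_def cquat_def)
  then have Z: "Z = {z. z ^ n = 1}" unfolding n_def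
    using Z_fin Z_one mult
    by (intro finite_mult_closed_eq_roots_unity) (auto simp: Z_def simp flip: cquat_mult[OF b])
  have "odd n"
  proof
    assume "even n"
    then have "-1 \<in> Z" unfolding Z by simp
    then show False using neg by (simp add: Z_def cquat_minus_one)
  qed
  have "H = dihedral_image b u n"
  proof
    show "dihedral_image b u n \<subseteq> H"
      using mult sH unfolding dihedral_image_def Z[symmetric] by (auto simp: Z_def su)
    show "H \<subseteq> dihedral_image b u n"
    proof
      fix A assume A: "A \<in> H"
      then have "A \<in> carrier U2pm" using HU by blast
      then obtain c w v where q: "c = 1 \<or> c = \<i>" "w\<^sup>2 + v \<bullet> v = 1" "A = quat c w v"
        by (rule U2pm_cases)
      have *: "\<exists>z\<in>Z. quat 1 w v = cquat b z" if "quat 1 w v \<in> H" for w v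
        using that K_cquat[OF that] by (auto simp: Z_def)
      from q(1) show "A \<in> dihedral_image b u n"
      proof
        assume "c = 1"
        then obtain z where "z \<in> Z" "A = cquat b z" using * A q(3) by blast
        then show ?thesis unfolding dihedral_image_def Z[symmetric] by blast
      next
        assume "c = \<i>"
        \<comment> \<open>Both factors carry the scalar \<open>\<i>\<close>, so their product has
          determinant one; multiplying back by the involution \<open>s\<close> recovers
          \<open>A\<close>.\<close>
        then have "\<exists>w' v'. A ** s = quat 1 w' v'"
          by (auto simp: q(3) su quat_mult quat_uminus_scalar)
        then obtain z where z: "z \<in> Z" "A ** s = cquat b z" using * mult[OF A sH] by metis
        then have "A = cquat b z ** s" by (metis ss matrix_mul_assoc matrix_mul_rid)
        then show ?thesis using z(1) unfolding dihedral_image_def Z[symmetric] su by blast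
      qed
    qed
  qed
  then show thesis using that b u bu \<open>odd n\<close> by blast
qed

text \<open>Two different elements of \<open>H\<close> with the same image would be negatives of
  each other, and their quotient, minus one, would lie in \<open>H\<close>.\<close>

lemma rho_iso_image:
  assumes sub: "subgroup H U2pm" and neg: "- mat 1 \<notin> H"
  shows "rho \<in> iso (U2pm\<lparr>carrier := H\<rparr>) (O3\<lparr>carrier := rho ` H\<rparr>)"
proof -
  have HU: "H \<subseteq> carrier U2pm" using sub by (rule subgroup.subset)
  have "inj_on rho H"
  proof (rule inj_onI, rule ccontr)
    fix A A' assume A: "A \<in> H" "A' \<in> H" "rho A = rho A'" "A \<noteq> A'"
    then have "A = - A'" using rho_eq_iff HU by blast
    then have "A \<otimes>\<^bsub>U2pm\<^esub> inv\<^bsub>U2pm\<^esub> A' = - mat 1 \<otimes>\<^bsub>U2pm\<^esub> A' \<otimes>\<^bsub>U2pm\<^esub> inv\<^bsub>U2pm\<^esub> A'"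
      by (simp add: minus_one_mult)
    also have "\<dots> = - mat 1"
      using subsetD[OF HU A(2)] minus_one_in_U2pm
      by (simp only: U2pm.m_assoc U2pm.inv_closed U2pm.r_inv U2pm.r_one)
    finally show False
      using neg subgroup.m_closed[OF sub A(1) subgroup.m_inv_closed[OF sub A(2)]] by simp
  qed
  then show ?thesis
    using rho.induced_group_hom[OF sub]
    by (simp add: iso_def bij_betw_def group_hom_def group_hom_axioms_def)
qed

theorem proposition3p19:
  shows "group_hom U2pm O3 rho
    \<and> bij_betw (\<lambda>G. {A \<in> carrier U2pm. rho A \<in> G})
        (finite_reflection_subgroups O3 reflections_O3)
        {H \<in> finite_reflection_subgroups U2pm reflections_U2pm. - mat 1 \<in> H}
    \<and> (\<forall>H \<in> finite_reflection_subgroups U2pm reflections_U2pm. - mat 1 \<notin> H \<longrightarrow>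
         (\<exists>m. U2pm\<lparr>carrier := H\<rparr> \<cong> dihedral (2 * m + 1))
         \<and> rho \<in> iso (U2pm\<lparr>carrier := H\<rparr>) (O3\<lparr>carrier := rho ` H\<rparr>))
    \<and> (\<forall>m. \<exists>H \<in> finite_reflection_subgroups U2pm reflections_U2pm. - mat 1 \<notin> H
         \<and> U2pm\<lparr>carrier := H\<rparr> \<cong> dihedral (2 * m + 1))"
proof (intro conjI ballI allI impI)
  show "group_hom U2pm O3 rho" by (rule group_hom_rho)
  show "bij_betw (\<lambda>G. {A \<in> carrier U2pm. rho A \<in> G})
        (finite_reflection_subgroups O3 reflections_O3)
        {H \<in> finite_reflection_subgroups U2pm reflections_U2pm. - mat 1 \<in> H}"
    by (rule bij_betw_preimage_rho)
next
  fix H assume H: "H \<in> finite_reflection_subgroups U2pm reflections_U2pm" "- mat 1 \<notin> H"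
  obtain b u n where D: "b \<bullet> b = 1" "u \<bullet> u = 1" "b \<bullet> u = 0" "odd n" "H = dihedral_image b u n"
    by (rule reflection_subgroup_eq_dihedral_image[OF H])
  have "n > 0" using D(4) by (auto intro: Nat.gr0I)
  then have "U2pm\<lparr>carrier := H\<rparr> \<cong> dihedral n"
    using dihedral_image_subgroup(2) D by blast
  then show "\<exists>m. U2pm\<lparr>carrier := H\<rparr> \<cong> dihedral (2 * m + 1)" using D(4) by (metis oddE)
  show "rho \<in> iso (U2pm\<lparr>carrier := H\<rparr>) (O3\<lparr>carrier := rho ` H\<rparr>)"
    using H by (intro rho_iso_image) (auto simp: finite_reflection_subgroups_def)
next
  fix m :: nat
  \<comment> \<open>Any orthonormal pair of axis and reflection vector would do.\<close>
  let ?b = "axis 1 1 :: real^3" and ?u = "axis 2 1 :: real^3"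
  have bu: "?b \<bullet> ?b = 1" "?u \<bullet> ?u = 1" "?b \<bullet> ?u = 0" by (simp_all add: inner_axis_axis)
  show "\<exists>H \<in> finite_reflection_subgroups U2pm reflections_U2pm. - mat 1 \<notin> H
         \<and> U2pm\<lparr>carrier := H\<rparr> \<cong> dihedral (2 * m + 1)"
    using dihedral_image_generated[OF bu] minus_one_notin_dihedral_image[OF bu] dihedral_image_subgroup(2)[OF bu]
    by (intro bexI[of _ "dihedral_image ?b ?u (2 * m + 1)"]) auto
qed

end
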